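(* The Jones polynomial $X(G)=(-a)^{-3w(G)}\langle G\rangle$ is an invariant of graph-knots.
   Context: A labeled graph is a finite simple graph $G$ (no loops, no multiple edges) in which every vertex carries a label '$+$' or '$-$' (identified with the signs $+1,-1$). $V(G)$ is the vertex set and $N(v)$ is the set of all vertices adjacent to $v$. $A(G)$ is the adjacency matrix over $\mathbb{Z}_2$ (with zero diagonal), $E$ is the identity matrix; all matrices are over $\mathbb{Z}_2$. For an $m\times m$ matrix $M$, $\operatorname{corank}M=m-\operatorname{rank}M$ (the corank of the empty matrix is $0$). To change the adjacency of a pair of vertices means to join them by an edge if they are not adjacent and to delete the edge if they are adjacent. States and Kauffman bracket: a state is any subset $s\subseteq V(G)$; $G(s)$ is the induced subgraph on $s$. Let $\alpha(s)$ be the number of vertices in $s$ labeled '$-$' plus the number of vertices in $V(G)\setminus s$ labeled '$+$', and $\beta(s)=n-\alpha(s)$ with $n=|V(G)|$. The Kauffman bracket polynomial is $$\langle G\rangle=\sum_{s\subseteq V(G)}a^{\alpha(s)-\beta(s)}(-a^2-a^{-2})^{\operatorname{corank}A(G(s))}.$$ Graph-moves. $\Omega_g1$: addition/removal of an isolated vertex labeled '$+$' or '$-$'. $\Omega_g2$: addition/removal of two vertices not connected by an edge, having different signs and the same adjacency with the other vertices. $\Omega_g3$: let $u,v,w$ be three vertices of $G$ all having label '$-$' such that $u$ is adjacent in $G$ only to $v$ and $w$; then change only the adjacency of $u$ with the vertices $t\in (N(v)\setminus N(w))\cup(N(w)\setminus N(v))$ (for other pairs of vertices the adjacency is not changed),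 and in addition change the labels of $v$ and $w$ to '$+$'; the inverse operation is also called $\Omega_g3$. $\Omega_g4$: take two adjacent vertices $u$ labeled $\epsilon$ and $v$ labeled $\delta$, $\epsilon,\delta\in\{\pm1\}$; change the labels so that the label of $u$ becomes $-\delta$ and the label of $v$ becomes $-\epsilon$; in addition, change the adjacency for each pair $(t,w)$ of vertices where $t\in N(u)$, $w\in N(v)\setminus N(u)$ and where $t\in N(v)$, $w\in N(u)\setminus N(v)$. A graph-link is an equivalence class of labeled graphs modulo the moves $\Omega_g1$–$\Omega_g4$. A graph-link $\{G\}$ is called a graph-knot if $\operatorname{corank}(A(G')+E)=0$ for any representative $G'$ of the graph-link. Writhe number: for a labeled graph $G$ with $\operatorname{corank}(A(G)+E)=0$ and vertices enumerated $v_1,\dots,v_n$, put $B_i(G)=A(G)+E+E_{ii}$, where $E_{ii}$ has its only nonzero entry, equal to $1$, in the $i$-th row and $i$-th column, and $$w(G)=\sum_{i=1}^n(-1)^{\operatorname{corank}B_i(G)}\operatorname{sign}v_i,$$ where $\operatorname{sign}v_i=\pm1$ is the label of $v_i$. For a graph-knot, $X$ is computed from a representative $G$ by the formula in the claim.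
   Formalization: As printed, Ω_g3 and Ω_g4 change corank(A+E), so no graph-knots exist. Proved with N(v), N(w) in Ω_g3 read as closed neighbourhoods (the printed Ω_g3 is included as a vacuous case) and with the pairs in Ω_g4 avoiding u and v. *)

theory Defs
  imports
    "HOL-Library.Z2"
    "HOL-Computational_Algebra.Formal_Laurent_Series"
    "Jordan_Normal_Form.DL_Rank"
begin

section \<open>Labeled graphs\<close>

text \<open>Vertices are natural numbers: up to isomorphism this covers all finite graphs and always
  leaves room for new vertices. Labels are the signs \<open>1\<close> and \<open>-1\<close>; the value of
  \<open>lab\<close> outside the vertex set is irrelevant.\<close>

record lgraph =
  verts :: "nat set"
  adj :: "nat \<Rightarrow> nat \<Rightarrow> bool"
  lab :: "nat \<Rightarrow> int"

definition labeled_graph :: "lgraph \<Rightarrow> bool" where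
  "labeled_graph G \<longleftrightarrow>
     finite (verts G) \<and>
     (\<forall>x y. adj G x y \<longrightarrow> x \<in> verts G \<and> y \<in> verts G) \<and>
     (\<forall>x y. adj G x y \<longrightarrow> adj G y x) \<and>
     (\<forall>x. \<not> adj G x x) \<and>
     (\<forall>x \<in> verts G. lab G x = 1 \<or> lab G x = - 1)"

definition nbhd :: "lgraph \<Rightarrow> nat \<Rightarrow> nat set" where
  "nbhd G v = {x \<in> verts G. adj G v x}"

definition closed_nbhd :: "lgraph \<Rightarrow> nat \<Rightarrow> nat set" where
  "closed_nbhd G v = insert v (nbhd G v)"

definition induced :: "lgraph \<Rightarrow> nat set \<Rightarrow> lgraph" where
  "induced G s = G\<lparr>verts := s, adj := (\<lambda>x y. x \<in> s \<and> y \<in> s \<and> adj G x y)\<rparr>"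


section \<open>Matrices over the two-element field\<close>

definition corank :: "bit mat \<Rightarrow> nat" where
  "corank M = dim_row M - vec_space.rank (dim_row M) M"

definition vlist :: "lgraph \<Rightarrow> nat list" where
  "vlist G = sorted_list_of_set (verts G)"

definition order_of :: "lgraph \<Rightarrow> nat" where
  "order_of G = card (verts G)"

definition adj_mat :: "lgraph \<Rightarrow> bit mat" where
  "adj_mat G = mat (order_of G) (order_of G)
     (\<lambda>(i, j). of_bool (adj G (vlist G ! i) (vlist G ! j)))"

definition unit_diag_mat :: "nat \<Rightarrow> nat \<Rightarrow> bit mat" where
  "unit_diag_mat n i = mat n n (\<lambda>(k, l). of_bool (k = i \<and> l = i))"


section \<open>Kauffman bracket, writhe number and Jones polynomial\<close>

text \<open>Laurent polynomials in \<open>a\<close> are regarded as formal Laurent series over the rationals, with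
  \<open>a = fls_X\<close>; this is a field, so integer powers are available.\<close>

definition state_alpha :: "lgraph \<Rightarrow> nat set \<Rightarrow> int" where
  "state_alpha G s =
     int (card {v \<in> s. lab G v = - 1}) + int (card {v \<in> verts G - s. lab G v = 1})"

definition state_beta :: "lgraph \<Rightarrow> nat set \<Rightarrow> int" where
  "state_beta G s = int (order_of G) - state_alpha G s"

definition kauffman_bracket :: "lgraph \<Rightarrow> rat fls" where
  "kauffman_bracket G =
     (\<Sum>s \<in> Pow (verts G).
        fls_X powi (state_alpha G s - state_beta G s) *
        (- (fls_X powi 2) - fls_X powi (- 2)) ^ corank (adj_mat (induced G s)))"

definition B_mat :: "lgraph \<Rightarrow> nat \<Rightarrow> bit mat" where
  "B_mat G i = adj_mat G + 1\<^sub>m (order_of G) + unit_diag_mat (order_of G) i"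

definition writhe :: "lgraph \<Rightarrow> int" where
  "writhe G = (\<Sum>i < order_of G. (- 1) ^ corank (B_mat G i) * lab G (vlist G ! i))"

definition jones :: "lgraph \<Rightarrow> rat fls" where
  "jones G = (- fls_X) powi (- 3 * writhe G) * kauffman_bracket G"


section \<open>Graph-moves\<close>

definition agree_on :: "nat set \<Rightarrow> lgraph \<Rightarrow> lgraph \<Rightarrow> bool" where
  "agree_on S G H \<longleftrightarrow>
     (\<forall>x \<in> S. lab G x = lab H x) \<and> (\<forall>x \<in> S. \<forall>y \<in> S. adj G x y \<longleftrightarrow> adj H x y)"

definition lgraph_iso :: "lgraph \<Rightarrow> lgraph \<Rightarrow> bool" where
  "lgraph_iso G H \<longleftrightarrow>
     (\<exists>f. bij_betw f (verts G) (verts H) \<and>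
          (\<forall>x \<in> verts G. lab H (f x) = lab G x) \<and>
          (\<forall>x \<in> verts G. \<forall>y \<in> verts G. adj H (f x) (f y) \<longleftrightarrow> adj G x y))"

text \<open>The first two moves are given in the direction that adds vertices, the third in the direction
  that turns two negative labels into positive ones; the inverse moves come from the equivalence
  closure below.\<close>

definition omega1 :: "lgraph \<Rightarrow> lgraph \<Rightarrow> bool" where
  "omega1 G H \<longleftrightarrow>
     (\<exists>x. x \<notin> verts G \<and> verts H = insert x (verts G) \<and> agree_on (verts G) G H \<and>
          nbhd H x = {})"

definition omega2 :: "lgraph \<Rightarrow> lgraph \<Rightarrow> bool" where
  "omega2 G H \<longleftrightarrow>
     (\<exists>x y. x \<noteq> y \<and> x \<notin> verts G \<and> y \<notin> verts G \<and>
            verts H = {x, y} \<union> verts G \<and> agree_on (verts G) G H \<and>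
            \<not> adj H x y \<and> lab H x = - lab H y \<and>
            (\<forall>t \<in> verts G. adj H x t \<longleftrightarrow> adj H y t))"

text \<open>\<open>N\<close> is the notion of neighbourhood used in the symmetric difference
  \<open>(N(v) - N(w)) \<union> (N(w) - N(v))\<close>. Read verbatim, \<open>N\<close> is \<open>nbhd\<close>. That move does not
  preserve the bracket: for the path v-u-w with all labels negative, it only changes the labels of
  \<open>v\<close> and \<open>w\<close>. It does not preserve the corank of \<open>A(G) + E\<close> either, so that the resulting notion
  of graph-knot is empty. With \<open>closed_nbhd\<close> the pairs \<open>u, v\<close> and \<open>u, w\<close> are changed too
  exactly when \<open>v\<close> and \<open>w\<close> are not adjacent, and the move is then compatible with both.
  For all other vertices the two choices agree. The development is
  parameterised so as to cover both.\<close>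

definition omega3 :: "(lgraph \<Rightarrow> nat \<Rightarrow> nat set) \<Rightarrow> lgraph \<Rightarrow> lgraph \<Rightarrow> bool" where
  "omega3 N G H \<longleftrightarrow>
     (\<exists>u v w. {u, v, w} \<subseteq> verts G \<and> u \<noteq> v \<and> u \<noteq> w \<and> v \<noteq> w \<and>
        lab G u = - 1 \<and> lab G v = - 1 \<and> lab G w = - 1 \<and> nbhd G u = {v, w} \<and>
        verts H = verts G \<and>
        lab H v = 1 \<and> lab H w = 1 \<and> (\<forall>x \<in> verts G - {v, w}. lab H x = lab G x) \<and>
        (let T = (N G v - N G w) \<union> (N G w - N G v) in
         \<forall>x \<in> verts G. \<forall>y \<in> verts G.
           adj H x y \<longleftrightarrow> (adj G x y \<noteq> (x = u \<and> y \<in> T \<or> y = u \<and> x \<in> T))))"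

text \<open>The pairs whose adjacency is changed consist of vertices other than \<open>u\<close> and \<open>v\<close>; otherwise
  the move would isolate \<open>u\<close> and \<open>v\<close>. Each unordered pair is changed at most once.\<close>

definition pivot_pair :: "lgraph \<Rightarrow> nat \<Rightarrow> nat \<Rightarrow> nat \<Rightarrow> nat \<Rightarrow> bool" where
  "pivot_pair G u v t w \<longleftrightarrow>
     t \<notin> {u, v} \<and> w \<notin> {u, v} \<and>
     (t \<in> nbhd G u \<and> w \<in> nbhd G v - nbhd G u \<or>
      t \<in> nbhd G v \<and> w \<in> nbhd G u - nbhd G v)"

definition omega4 :: "lgraph \<Rightarrow> lgraph \<Rightarrow> bool" where
  "omega4 G H \<longleftrightarrow>
     (\<exists>u v. u \<in> verts G \<and> v \<in> verts G \<and> adj G u v \<and> verts H = verts G \<and>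
        lab H u = - lab G v \<and> lab H v = - lab G u \<and>
        (\<forall>x \<in> verts G - {u, v}. lab H x = lab G x) \<and>
        (\<forall>x \<in> verts G. \<forall>y \<in> verts G.
           adj H x y \<longleftrightarrow> (adj G x y \<noteq> (pivot_pair G u v x y \<or> pivot_pair G u v y x))))"


section \<open>Graph-links and graph-knots\<close>

text \<open>Graphs are considered up to isomorphism. This adds nothing to the relation generated by the
  moves: adding and removing pairs of vertices by the second move renames vertices.\<close>

definition graph_move :: "(lgraph \<Rightarrow> nat \<Rightarrow> nat set) \<Rightarrow> lgraph \<Rightarrow> lgraph \<Rightarrow> bool" where
  "graph_move N G H \<longleftrightarrow>
     labeled_graph G \<and> labeled_graph H \<and>
     (lgraph_iso G H \<or> omega1 G H \<or> omega2 G H \<or> omega3 N G H \<or> omega4 G H)"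

definition link_rel :: "(lgraph \<Rightarrow> nat \<Rightarrow> nat set) \<Rightarrow> (lgraph \<times> lgraph) set" where
  "link_rel N =
     {(G, H). labeled_graph G \<and> labeled_graph H \<and> equivclp (graph_move N) G H}"

definition graph_links :: "(lgraph \<Rightarrow> nat \<Rightarrow> nat set) \<Rightarrow> lgraph set set" where
  "graph_links N = Collect labeled_graph // link_rel N"

definition graph_knot :: "(lgraph \<Rightarrow> nat \<Rightarrow> nat set) \<Rightarrow> lgraph set \<Rightarrow> bool" where
  "graph_knot N K \<longleftrightarrow>
     K \<in> graph_links N \<and> (\<forall>G \<in> K. corank (adj_mat G + 1\<^sub>m (order_of G)) = 0)"

end

theory Submission
  imports Defs
begin

text \<open>Coranks over the two-element field are read off from the number of kernel vectors, so that they
  can be compared by exhibiting bijections of kernels. Each move acts on the adjacency matrix, up to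
  isolated and pendant vertices, as a congruence \<open>P M P\<^sup>T\<close>; this matches the states of both
  graphs and gives the behaviour of the bracket.

  For the writhe, let \<open>M = A + E\<close> be invertible. Then \<open>corank (M + E\<^sub>i\<^sub>i)\<close> is the
  \<open>i\<close>-th diagonal entry of the inverse of \<open>M\<close>, and the third and fourth moves are congruences of
  \<open>M\<close> as well. Hence only the diagonal entries at two vertices change, and their change
  compensates the change of labels. The first move changes the writhe by the sign of the isolated vertex,
  which cancels the factor \<open>- a\<^sup>\<plusminus>\<^sup>3\<close> of the bracket.

  With the open neighbourhood there is nothing to prove: every graph-link then contains a graph with
  singular \<open>A + E\<close>.\<close>

text \<open>A congruence of the whole matrix does not restrict to induced subgraphs, so one
  congruence cannot settle all states. The states are therefore sorted by which of the two or three
  moved vertices they contain; each pattern gets its own elimination, and the partial sums are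
  recombined by an identity in \<open>a\<close>, which for the first three moves rests on the value
  \<open>- a^2 - a^-2\<close> of a loop. Kernels are counted among functions on vertices rather than
  vectors with numbered entries, because the eliminations delete and rename vertices.

  For the writhe, \<open>det (M + E_ii) = det M * (1 + z_ii)\<close> with \<open>z\<close> the
  inverse of \<open>M\<close>, so vertex \<open>i\<close> contributes its sign times
  \<open>1 - 2 z_ii\<close>. The third and fourth moves use \<open>P = 1 + c d^T\<close> with
  \<open>d\<close> supported on the two relabelled vertices; \<open>z_ii\<close> cannot change
  elsewhere, and \<open>d^T M d = 0\<close> because the two diagonal ones cancel.

  Invertibility of \<open>A + E\<close> is not transported along moves: all graphs in a chain of
  moves belong to the class, and being a graph-knot supplies it at both ends.\<close>

section \<open>Corank and kernel size\<close>

text \<open>These default rules replace addition and multiplication of bits by bit operations, for which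
  no ring lemmas are available.\<close>

declare add_bit_eq_xor [simp del] mult_bit_eq_and [simp del]

text \<open>Coordinates with respect to a finite basis identify the vectors with the functions from
  the basis to the field.\<close>

lemma (in vectorspace) card_carrier_eq_power_dim:
  assumes "fin_dim"
  shows "card (carrier V) = card (carrier K) ^ dim"
proof -
  from finite_basis_exists[OF assms] obtain B where B: "finite B" "basis B" by blast
  from B have BC: "B \<subseteq> carrier V" by (simp add: basis_def)
  have ex1: "\<exists>!a. a \<in> B \<rightarrow>\<^sub>E carrier K \<and> lincomb a B = v" if "v \<in> carrier V" for v
    using basis_criterion[OF B(1) BC] B(2) that by blast
  have "bij_betw (\<lambda>a. lincomb a B) (B \<rightarrow>\<^sub>E carrier K) (carrier V)"
    unfolding bij_betw_def
  proof
    have cl: "lincomb a B \<in> carrier V" if "a \<in> B \<rightarrow>\<^sub>E carrier K" for a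
      using BC that by (intro lincomb_closed) auto
    show "inj_on (\<lambda>a. lincomb a B) (B \<rightarrow>\<^sub>E carrier K)"
      by (rule inj_onI) (use ex1 cl in metis)
    show "(\<lambda>a. lincomb a B) ` (B \<rightarrow>\<^sub>E carrier K) = carrier V"
      using ex1 cl by blast
  qed
  then have "card (carrier V) = card (B \<rightarrow>\<^sub>E carrier K)"
    by (simp add: bij_betw_same_card)
  then show ?thesis
    using B by (simp add: card_funcsetE dim_basis)
qed

text \<open>\<open>rank\<close> is defined as the dimension of the column span; seeing this span as
  the image of the map is what allows rank and kernel to be compared by counting.\<close>

lemma (in vec_space) span_cols_eq_range:
  assumes A: "A \<in> carrier_mat n m"
  shows "span (set (cols A)) = (\<lambda>v. A *\<^sub>v v) ` carrier_vec m"
proof -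
  have C: "set (cols A) \<subseteq> carrier_vec n" using A cols_dim by blast
  have len: "length (cols A) = m" using A by simp
  have "mat_of_cols n (cols A) = A"
    using A by (metis carrier_matD(1) mat_of_cols_cols)
  moreover have "\<forall>w \<in> set (cols A). dim_vec w = n"
    using C by auto
  ultimately have lm: "lincomb_list c (cols A) = A *\<^sub>v vec m c" for c
    using lincomb_list_as_mat_mult[of "cols A" c] unfolding len by simp
  have "span (set (cols A)) = {lincomb a (set (cols A)) | a. a \<in> set (cols A) \<rightarrow> carrier class_ring}"
    by (subst finite_span) (use C in auto)
  also have "\<dots> = (\<lambda>v. A *\<^sub>v v) ` carrier_vec m"
  proof (intro equalityI subsetI)
    fix y assume "y \<in> {lincomb a (set (cols A)) | a. a \<in> set (cols A) \<rightarrow> carrier class_ring}"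
    then obtain a where "y = lincomb a (set (cols A))" by blast
    then show "y \<in> (\<lambda>v. A *\<^sub>v v) ` carrier_vec m"
      by (auto simp: lincomb_as_lincomb_list[OF C] lm)
  next
    fix y assume "y \<in> (\<lambda>v. A *\<^sub>v v) ` carrier_vec m"
    then obtain v where v: "v \<in> carrier_vec m" "y = A *\<^sub>v v" by blast
    then have "vec m (\<lambda>i. v $ i) = v" by auto
    then have "y = lincomb_list (\<lambda>i. v $ i) (cols A)" using v by (simp add: lm)
    \<comment> \<open>The span is taken over the set of columns, so \<open>mk_coeff\<close> adds up
      the coefficients of equal columns.\<close>
    then have "y = lincomb (mk_coeff (cols A) (\<lambda>i. v $ i)) (set (cols A))"
      by (simp add: lincomb_list_as_lincomb C)
    then show "y \<in> {lincomb a (set (cols A)) | a. a \<in> set (cols A) \<rightarrow> carrier class_ring}"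
      by auto
  qed
  finally show ?thesis .
qed

lemma card_eq_card_fibre_times_card_image:
  assumes "finite S" "\<And>y. y \<in> f ` S \<Longrightarrow> card {x \<in> S. f x = y} = k"
  shows "card S = k * card (f ` S)"
proof -
  have "card S = (\<Sum>y\<in>f ` S. \<Sum>x\<in>{x \<in> S. f x = y}. 1)"
    using sum.image_gen[OF assms(1), of "\<lambda>_. 1::nat" f] by simp
  also have "\<dots> = (\<Sum>y\<in>f ` S. k)" using assms(2) by (intro sum.cong) auto
  finally show ?thesis by simp
qed

lemma card_UNIV_bit_eq: "card (UNIV :: bit set) = 2"
proof -
  have "(UNIV :: bit set) = {0, 1}" 
    by (auto intro: bit_not_one_iff[THEN iffD1])
  then have "card (UNIV :: bit set) = card {0, 1 :: bit}" by (rule arg_cong)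
  then show ?thesis by simp
qed

lemma card_carrier_vec_bit: "card (carrier_vec n :: bit vec set) = 2 ^ n"
proof -
  interpret vec_space "TYPE(bit)" n .
  have "card (UNIV :: bit set) = 2"
    by (rule card_UNIV_bit_eq)
  then show ?thesis
    using card_carrier_eq_power_dim[OF fin_dim] by (simp add: dim_is_n)
qed

text \<open>Rank-nullity by counting: the nonempty fibres are translates of the kernel, so
  \<open>2 ^ n\<close> is the kernel size times \<open>2 ^ rank A\<close>.\<close>

lemma card_kernel_eq_power_corank:
  fixes A :: "bit mat"
  assumes A: "A \<in> carrier_mat n n"
  shows "card {v \<in> carrier_vec n. A *\<^sub>v v = 0\<^sub>v n} = 2 ^ corank A"
proof -
  interpret vec_space "TYPE(bit)" n .
  let ?T = "\<lambda>v. A *\<^sub>v v"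
  let ?ker = "{v \<in> carrier_vec n. A *\<^sub>v v = 0\<^sub>v n}"
  note bit = card_UNIV_bit_eq
  have C: "set (cols A) \<subseteq> carrier_vec n" using A cols_dim by blast
  have fin: "finite (carrier_vec n :: bit vec set)"
    by (rule card_ge_0_finite) (simp add: card_carrier_vec_bit)
  have "vectorspace class_ring (span_vs (set (cols A)))"
    using C span_is_subspace subspace_is_vs by simp
  from vectorspace.card_carrier_eq_power_dim[OF this fin_dim_span_cols[OF A]]
  have im: "card (?T ` carrier_vec n) = 2 ^ rank A"
    by (simp add: rank_def bit flip: span_cols_eq_range[OF A])
  have "card {x \<in> carrier_vec n. ?T x = y} = card ?ker" if "y \<in> ?T ` carrier_vec n" for y
  proof -
    from that obtain v where v: "v \<in> carrier_vec n" "y = A *\<^sub>v v" by blast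
    have "bij_betw (\<lambda>x. v + x) ?ker {x \<in> carrier_vec n. ?T x = y}"
    proof (rule bij_betwI[where g = "\<lambda>x. x - v"])
      show "(\<lambda>x. v + x) \<in> ?ker \<rightarrow> {x \<in> carrier_vec n. ?T x = y}"
        using v A by (auto simp: mult_add_distrib_mat_vec[OF A])
      show "(\<lambda>x. x - v) \<in> {x \<in> carrier_vec n. ?T x = y} \<rightarrow> ?ker"
        using v A by (auto simp: mult_minus_distrib_mat_vec[OF A])
    qed (use v in auto)
    then show ?thesis by (simp add: bij_betw_same_card)
  qed
  from card_eq_card_fibre_times_card_image[OF fin this]
  have "2 ^ n = card ?ker * 2 ^ rank A"
    by (simp add: im card_carrier_vec_bit)
  moreover have "rank A \<le> n" by (rule rank_le_nc[OF A])
  then have "(2::nat) ^ n = 2 ^ (n - rank A) * 2 ^ rank A" 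
    by (simp flip: power_add)
  ultimately have "card ?ker = 2 ^ (n - rank A)" by simp
  then show ?thesis using A by (simp add: corank_def)
qed

section \<open>Kernels of matrices indexed by vertex sets\<close>

lemma bit_add_self_left [simp]: "(x :: bit) + (x + y) = y"
  by (cases x) simp_all

lemma bit_add_eq_0_iff: "(x :: bit) + y = 0 \<longleftrightarrow> x = y"
  by (cases x; cases y) simp_all

text \<open>Vectors are total functions that vanish off \<open>S\<close>. Vectors for different
  vertex sets thus share one type, and each kernel vector is represented exactly once, so kernels
  can be counted.\<close>

definition supported :: "nat set \<Rightarrow> (nat \<Rightarrow> bit) set" where
  "supported S = {z. \<forall>i. i \<notin> S \<longrightarrow> z i = 0}"

definition mulv :: "nat set \<Rightarrow> (nat \<Rightarrow> nat \<Rightarrow> bit) \<Rightarrow> (nat \<Rightarrow> bit) \<Rightarrow> nat \<Rightarrow> bit" where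
  "mulv S M z i = (\<Sum>j\<in>S. M i j * z j)"

definition null_vecs :: "nat set \<Rightarrow> (nat \<Rightarrow> nat \<Rightarrow> bit) \<Rightarrow> (nat \<Rightarrow> bit) set" where
  "null_vecs S M = {z \<in> supported S. \<forall>i\<in>S. mulv S M z i = 0}"

definition mat_on :: "nat set \<Rightarrow> (nat \<Rightarrow> nat \<Rightarrow> bit) \<Rightarrow> bit mat" where
  "mat_on S M = mat (card S) (card S)
     (\<lambda>(i, j). M (sorted_list_of_set S ! i) (sorted_list_of_set S ! j))"

definition nullity :: "nat set \<Rightarrow> (nat \<Rightarrow> nat \<Rightarrow> bit) \<Rightarrow> nat" where
  "nullity S M = corank (mat_on S M)"

lemma supported_add: "x \<in> supported S \<Longrightarrow> y \<in> supported S \<Longrightarrow> (\<lambda>i. x i + y i) \<in> supported S"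
  by (simp add: supported_def)

lemma bij_betw_nth_sorted_list:
  assumes "finite S"
  shows "bij_betw ((!) (sorted_list_of_set S)) {..<card S} S"
  using assms by (intro bij_betw_nth) auto

lemma sum_nth_sorted_list:
  assumes "finite S"
  shows "(\<Sum>j<card S. f (sorted_list_of_set S ! j)) = (\<Sum>x\<in>S. f x)"
  by (rule sum.reindex_bij_betw[OF bij_betw_nth_sorted_list[OF assms]])

text \<open>Kernel vectors of \<open>mat_on\<close> are carried along the sorted enumeration
  \<open>g\<close> of \<open>S\<close> and its inverse \<open>h\<close>. From here on the order of
  the vertices is invisible.\<close>

lemma card_null_vecs:
  assumes S: "finite S"
  shows "card (null_vecs S M) = 2 ^ nullity S M"
proof -
  define g where "g = (!) (sorted_list_of_set S)"
  define h where "h = inv_into {..<card S} g"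
  have g: "bij_betw g {..<card S} S"
    unfolding g_def by (rule bij_betw_nth_sorted_list[OF S])
  then have gS: "g j \<in> S" if "j < card S" for j using that by (auto simp: bij_betw_def)
  have hg: "h (g j) = j" if "j < card S" for j
    using g that by (simp add: h_def bij_betw_def inv_into_f_f)
  have gh: "g (h x) = x" "h x < card S" if "x \<in> S" for x
    using g that f_inv_into_f[of x g "{..<card S}"] inv_into_into[of x g "{..<card S}"]
    by (auto simp: h_def bij_betw_def)
  have mat: "vec_index (mat_on S M *\<^sub>v vec (card S) (\<lambda>j. z (g j))) i = mulv S M z (g i)" if "i < card S" for z i
    using that sum_nth_sorted_list[OF S, of "\<lambda>y. M (g i) y * z y"]
    by (simp add: mat_on_def mulv_def scalar_prod_def atLeast0LessThan flip: g_def)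
  have "bij_betw (\<lambda>z. vec (card S) (\<lambda>j. z (g j))) (null_vecs S M)
    {v \<in> carrier_vec (card S). mat_on S M *\<^sub>v v = 0\<^sub>v (card S)}"
  proof (rule bij_betwI[where g = "\<lambda>v x. if x \<in> S then vec_index v (h x) else 0"])
    show "(\<lambda>z. vec (card S) (\<lambda>j. z (g j))) \<in> null_vecs S M \<rightarrow>
      {v \<in> carrier_vec (card S). mat_on S M *\<^sub>v v = 0\<^sub>v (card S)}"
    proof clarify
      fix z assume "z \<in> null_vecs S M"
      then show "vec (card S) (\<lambda>j. z (g j)) \<in> carrier_vec (card S) \<and>
        mat_on S M *\<^sub>v vec (card S) (\<lambda>j. z (g j)) = 0\<^sub>v (card S)"
        using mat[of _ z] gS by (auto simp: null_vecs_def mat_on_def)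
    qed
    show "(\<lambda>v x. if x \<in> S then vec_index v (h x) else 0) \<in>
      {v \<in> carrier_vec (card S). mat_on S M *\<^sub>v v = 0\<^sub>v (card S)} \<rightarrow> null_vecs S M"
    proof clarify
      fix v :: "bit vec"
      assume v: "v \<in> carrier_vec (card S)" "mat_on S M *\<^sub>v v = 0\<^sub>v (card S)"
      define z where "z = (\<lambda>x. if x \<in> S then vec_index v (h x) else 0)"
      have "vec (card S) (\<lambda>j. z (g j)) = v" using v(1) by (auto simp: z_def gS hg)
      then have "mulv S M z x = 0" if "x \<in> S" for x
        using mat[of "h x" z] gh[OF that] v(2) by simp
      then have "z \<in> null_vecs S M" by (simp add: null_vecs_def supported_def z_def)
      then show "(\<lambda>x. if x \<in> S then vec_index v (h x) else 0) \<in> null_vecs S M" by (simp add: z_def)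
    qed
    show "(\<lambda>x. if x \<in> S then vec_index (vec (card S) (\<lambda>j. z (g j))) (h x) else 0) = z" if "z \<in> null_vecs S M" for z
      using that by (auto simp: null_vecs_def supported_def gh)
    show "vec (card S) (\<lambda>j. if g j \<in> S then vec_index v (h (g j)) else 0) = v"
      if "v \<in> {v \<in> carrier_vec (card S). mat_on S M *\<^sub>v v = 0\<^sub>v (card S)}" for v
      using that by (auto simp: gS hg)
  qed
  then show ?thesis
    using card_kernel_eq_power_corank[of "mat_on S M" "card S"]
    by (simp add: bij_betw_same_card nullity_def mat_on_def)
qed

text \<open>The bijection may be arbitrary, not only linear, since the number of kernel vectors
  already determines the corank.\<close>

lemma nullity_eqI_bij:
  assumes "finite S" "finite S'" "bij_betw f (null_vecs S M) (null_vecs S' M')"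
  shows "nullity S M = nullity S' M'"
proof -
  have "(2::nat) ^ nullity S M = 2 ^ nullity S' M'"
    using bij_betw_same_card[OF assms(3)] assms(1,2) by (simp add: card_null_vecs)
  then show ?thesis by simp
qed

lemma nullity_eq_0_iff:
  assumes "finite S"
  shows "nullity S M = 0 \<longleftrightarrow> null_vecs S M = {\<lambda>_. 0}"
proof -
  have z: "(\<lambda>_. 0) \<in> null_vecs S M" by (simp add: null_vecs_def supported_def mulv_def)
  have "nullity S M = 0 \<longleftrightarrow> card (null_vecs S M) = 1" by (simp add: card_null_vecs[OF assms])
  also have "\<dots> \<longleftrightarrow> null_vecs S M = {\<lambda>_. 0}" using z by (auto simp: card_1_singleton_iff)
  finally show ?thesis .
qed

lemma nullity_cong:
  assumes "\<And>i j. i \<in> S \<Longrightarrow> j \<in> S \<Longrightarrow> M i j = M' i j"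
  shows "nullity S M = nullity S M'"
proof (cases "finite S")
  case True
  then have "set (sorted_list_of_set S) = S" "length (sorted_list_of_set S) = card S" by auto
  then have "sorted_list_of_set S ! i \<in> S" if "i < card S" for i
    using that nth_mem by metis
  then have "mat_on S M = mat_on S M'"
    by (intro eq_matI) (auto simp: mat_on_def assms)
  then show ?thesis by (simp add: nullity_def)
next
  case False
  \<comment> \<open>An infinite \<open>S\<close> has \<open>card S = 0\<close>, so both matrices are
    empty.\<close>
  then have "mat_on S M = mat_on S M'" by (intro eq_matI) (auto simp: mat_on_def)
  then show ?thesis by (simp add: nullity_def)
qed

lemma nullity_iso:
  assumes S: "finite S" and f: "bij_betw f S S'"
    and M: "\<And>i j. i \<in> S \<Longrightarrow> j \<in> S \<Longrightarrow> M' (f i) (f j) = M i j"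
  shows "nullity S' M' = nullity S M"
proof -
  define h where "h = inv_into S f"
  have hf: "h (f x) = x" if "x \<in> S" for x
    using f that by (simp add: h_def bij_betw_def inv_into_f_f)
  have fS: "f x \<in> S'" if "x \<in> S" for x using f that by (auto simp: bij_betw_def)
  have fh: "f (h x) = x" "h x \<in> S" if "x \<in> S'" for x
    using f that f_inv_into_f[of x f S] inv_into_into[of x f S]
    by (auto simp: h_def bij_betw_def)
  have mul: "mulv S' M' z (f i) = mulv S M (\<lambda>j. if j \<in> S then z (f j) else 0) i" if "i \<in> S" for z i
    unfolding mulv_def using sum.reindex_bij_betw[OF f, of "\<lambda>j. M' (f i) j * z j"] that
    by (simp add: M)
  have "bij_betw (\<lambda>z j. if j \<in> S then z (f j) else 0) (null_vecs S' M') (null_vecs S M)"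
  proof (rule bij_betwI[where g = "\<lambda>z j. if j \<in> S' then z (h j) else 0"])
    show "(\<lambda>z j. if j \<in> S then z (f j) else 0) \<in> null_vecs S' M' \<rightarrow> null_vecs S M"
      by (auto simp: null_vecs_def supported_def fS simp flip: mul)
    show "(\<lambda>z j. if j \<in> S' then z (h j) else 0) \<in> null_vecs S M \<rightarrow> null_vecs S' M'"
    proof clarify
      fix z assume z: "z \<in> null_vecs S M"
      let ?z = "\<lambda>j. if j \<in> S' then z (h j) else 0"
      have "(\<lambda>j. if j \<in> S then ?z (f j) else 0) = z"
        using z by (auto simp: null_vecs_def supported_def fS hf)
      then have "mulv S' M' ?z i = 0" if "i \<in> S'" for i
        using mul[of "h i" ?z] fh[OF that] z by (simp add: null_vecs_def)
      then show "?z \<in> null_vecs S' M'" by (simp add: null_vecs_def supported_def)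
    qed
  qed (auto simp: null_vecs_def supported_def fS hf fh)
  then show ?thesis using S f bij_betw_finite by (intro nullity_eqI_bij) auto
qed

lemma mulv_insert:
  assumes "finite S" "x \<notin> S"
  shows "mulv (insert x S) M z i = M i x * z x + mulv S M z i"
  using assms by (simp add: mulv_def)

lemma mulv_cong:
  assumes "\<And>j. j \<in> S \<Longrightarrow> M i j * z j = M' i' j * z' j"
  shows "mulv S M z i = mulv S M' z' i'"
  using assms by (simp add: mulv_def)

lemma mulv_add: "mulv S M (\<lambda>j. x j + y j) i = mulv S M x i + mulv S M y i"
  by (simp add: mulv_def distrib_left sum.distrib)

lemma mulv_scale: "mulv S M (\<lambda>j. c * x j) i = c * mulv S M x i"
  by (simp add: mulv_def sum_distrib_left mult_ac)

text \<open>The coordinate at \<open>x\<close> decouples from the others: it is free if the diagonal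
  entry is 0 and forced to be 0 otherwise.\<close>

lemma nullity_insert_isolated:
  assumes S: "finite S" "x \<notin> S" and iso: "\<And>j. j \<in> S \<Longrightarrow> M x j = 0 \<and> M j x = 0"
  shows "nullity (insert x S) M = (if M x x = 0 then Suc (nullity S M) else nullity S M)"
proof -
  have row: "mulv S M z x = 0" for z by (simp add: mulv_def iso)
  have upd: "mulv S M (z(x := c)) i = mulv S M z i" for z c i
    using S by (intro mulv_cong) auto
  have "bij_betw (\<lambda>z. (z x, z(x := 0))) (null_vecs (insert x S) M)
     ({c. M x x * c = 0} \<times> null_vecs S M)"
    by (rule bij_betwI[where g = "\<lambda>(c, z). z(x := c)"])
       (use S in \<open>auto simp: null_vecs_def supported_def mulv_insert row upd iso\<close>)
  then have "card (null_vecs (insert x S) M) = card {c. M x x * c = 0} * card (null_vecs S M)"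
    by (simp add: bij_betw_same_card card_cartesian_product)
  moreover have "card {c. M x x * c = 0} = (if M x x = 0 then 2 else 1)"
    by (auto simp: card_UNIV_bit_eq)
  ultimately have "(2::nat) ^ nullity (insert x S) M =
    2 ^ (if M x x = 0 then Suc (nullity S M) else nullity S M)"
    using S by (simp add: card_null_vecs)
  then show ?thesis by simp
qed

text \<open>Row \<open>y\<close> forces \<open>z x = 0\<close>, after which row \<open>x\<close>
  determines \<open>z y\<close>. The rest of row \<open>x\<close> may be anything, so two vertices
  are eliminated at once.\<close>

lemma nullity_insert_pendant:
  assumes S: "finite S" "x \<notin> S" "y \<notin> S" "x \<noteq> y"
    and pend: "\<And>j. j \<in> S \<Longrightarrow> M y j = 0 \<and> M j y = 0" "M y y = 0" "M x y = 1" "M y x = 1"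
  shows "nullity (insert x (insert y S)) M = nullity S M"
proof (rule nullity_eqI_bij)
  have row: "mulv S M z y = 0" for z by (simp add: mulv_def pend)
  have upd: "mulv S M (z(y := c)) i = mulv S M z i" for z c i
    using S by (intro mulv_cong) auto
  have zx: "z x = 0" and zy: "z y = mulv S M z x" if "z \<in> null_vecs (insert x (insert y S)) M" for z
    using that S by (auto simp: null_vecs_def mulv_insert pend row bit_add_eq_0_iff)
  show "bij_betw (\<lambda>z. z(y := 0)) (null_vecs (insert x (insert y S)) M) (null_vecs S M)"
  proof (rule bij_betwI[where g = "\<lambda>z. z(y := mulv S M z x)"])
    show "(\<lambda>z. z(y := 0)) \<in> null_vecs (insert x (insert y S)) M \<rightarrow> null_vecs S M"
    proof
      fix z assume "z \<in> null_vecs (insert x (insert y S)) M"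
      with zx[OF this] show "z(y := 0) \<in> null_vecs S M"
        using S by (auto simp: null_vecs_def supported_def mulv_insert pend upd)
    qed
    show "(\<lambda>z. z(y := mulv S M z x)) \<in> null_vecs S M \<rightarrow> null_vecs (insert x (insert y S)) M"
      using S by (auto simp: null_vecs_def supported_def mulv_insert pend upd row)
    show "(z(y := 0))(y := mulv S M (z(y := 0)) x) = z" if "z \<in> null_vecs (insert x (insert y S)) M" for z
      by (simp add: upd flip: zy[OF that])
    show "(z(y := mulv S M z x))(y := 0) = z" if "z \<in> null_vecs S M" for z
      using that S by (auto simp: null_vecs_def supported_def)
  qed
qed (use S in auto)

section \<open>Congruences and diagonal entries of the inverse\<close>

definition sym_on :: "nat set \<Rightarrow> (nat \<Rightarrow> nat \<Rightarrow> bit) \<Rightarrow> bool" where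
  "sym_on S M \<longleftrightarrow> (\<forall>i\<in>S. \<forall>j\<in>S. M i j = M j i)"

lemma sum_mulv_commute:
  assumes "sym_on S M"
  shows "(\<Sum>k\<in>S. x k * mulv S M y k) = (\<Sum>k\<in>S. y k * mulv S M x k)"
proof -
  have "(\<Sum>k\<in>S. x k * mulv S M y k) = (\<Sum>k\<in>S. \<Sum>j\<in>S. x k * (M k j * y j))"
    by (simp add: mulv_def sum_distrib_left)
  also have "\<dots> = (\<Sum>j\<in>S. \<Sum>k\<in>S. x k * (M k j * y j))" by (rule sum.swap)
  also have "\<dots> = (\<Sum>j\<in>S. \<Sum>k\<in>S. y j * (M j k * x k))"
    using assms by (intro sum.cong) (auto simp: sym_on_def mult_ac)
  finally show ?thesis by (simp add: mulv_def sum_distrib_left)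
qed

text \<open>Entries of \<open>P M P\<^sup>T\<close> with \<open>P = 1 + c d\<^sup>T\<close>, for symmetric \<open>M\<close>; \<open>shear\<close> is
  \<open>P\<^sup>T\<close>, an involution if \<open>c\<close> and \<open>d\<close> are orthogonal.\<close>

definition congr :: "nat set \<Rightarrow> (nat \<Rightarrow> bit) \<Rightarrow> (nat \<Rightarrow> bit) \<Rightarrow> (nat \<Rightarrow> nat \<Rightarrow> bit) \<Rightarrow> nat \<Rightarrow> nat \<Rightarrow> bit" where
  "congr S c d M i j = M i j + c i * mulv S M d j + mulv S M d i * c j
     + c i * c j * (\<Sum>k\<in>S. d k * mulv S M d k)"

definition shear :: "nat set \<Rightarrow> (nat \<Rightarrow> bit) \<Rightarrow> (nat \<Rightarrow> bit) \<Rightarrow> (nat \<Rightarrow> bit) \<Rightarrow> nat \<Rightarrow> bit" where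
  "shear S c d z i = z i + (\<Sum>j\<in>S. c j * z j) * d i"

lemma mulv_shear: "mulv S M (shear S c d z) i = mulv S M z i + (\<Sum>j\<in>S. c j * z j) * mulv S M d i"
proof -
  have "shear S c d z = (\<lambda>i. z i + (\<Sum>j\<in>S. c j * z j) * d i)" by (simp add: shear_def fun_eq_iff)
  then show ?thesis by (simp add: mulv_add mulv_scale)
qed

lemma shear_shear:
  assumes "(\<Sum>j\<in>S. c j * d j) = 0"
  shows "shear S c d (shear S c d z) = z"
proof
  fix i
  have "(\<Sum>j\<in>S. c j * shear S c d z j) = (\<Sum>j\<in>S. c j * z j + (\<Sum>j\<in>S. c j * z j) * (c j * d j))"
    by (simp add: shear_def distrib_left mult_ac)
  also have "\<dots> = (\<Sum>j\<in>S. c j * z j)"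
    using assms by (simp add: sum.distrib flip: sum_distrib_left)
  finally show "shear S c d (shear S c d z) i = z i"
    by (simp add: shear_def[of S c d "shear S c d z"]) (simp add: shear_def add.assoc)
qed

text \<open>This is \<open>(P M P^T) z = P (M (P^T z))\<close>. Symmetry of \<open>M\<close> is what
  allows the row vector \<open>d^T M\<close> to be written as \<open>mulv S M d\<close> in
  \<open>congr\<close>.\<close>

lemma mulv_congr:
  assumes "sym_on S M"
  shows "mulv S (congr S c d M) z i =
    mulv S M (shear S c d z) i + c i * (\<Sum>k\<in>S. d k * mulv S M (shear S c d z) k)"
proof -
  let ?g = "\<Sum>j\<in>S. c j * z j"
  define D where "D = (\<Sum>k\<in>S. d k * mulv S M d k)"
  have "mulv S (congr S c d M) z i =
     mulv S M z i + c i * (\<Sum>j\<in>S. z j * mulv S M d j) + mulv S M d i * ?g + c i * D * ?g"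
    by (simp add: mulv_def[of S "congr S c d M"] mulv_def[of S M z i] congr_def distrib_left
      D_def[symmetric]
      distrib_right sum.distrib sum_distrib_left mult_ac)
  also have "(\<Sum>j\<in>S. z j * mulv S M d j) = (\<Sum>k\<in>S. d k * mulv S M z k)"
    by (rule sum_mulv_commute[OF assms])
  also have "mulv S M z i + c i * (\<Sum>k\<in>S. d k * mulv S M z k) + mulv S M d i * ?g + c i * D * ?g =
     mulv S M (shear S c d z) i + c i * (\<Sum>k\<in>S. d k * mulv S M (shear S c d z) k)"
    by (simp add: D_def mulv_shear distrib_left sum.distrib sum_distrib_left add_ac mult_ac)
  finally show ?thesis .
qed

text \<open>\<open>P\<close> is invertible because \<open>c\<close> and \<open>d\<close> are
  orthogonal, so \<open>P M P^T z = 0\<close> exactly when \<open>M\<close> annihilates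
  \<open>shear S c d z\<close>.\<close>

lemma nullity_congr:
  assumes S: "finite S" and sym: "sym_on S M" and cd: "(\<Sum>j\<in>S. c j * d j) = 0" and d: "d \<in> supported S"
    and M': "\<And>i j. i \<in> S \<Longrightarrow> j \<in> S \<Longrightarrow> M' i j = congr S c d M i j"
  shows "nullity S M' = nullity S M"
proof -
  have iff: "shear S c d z \<in> null_vecs S M \<longleftrightarrow> z \<in> null_vecs S (congr S c d M)" if "z \<in> supported S" for z
  proof -
    have s: "shear S c d z \<in> supported S" using that d by (auto simp: supported_def shear_def)
    let ?y = "mulv S M (shear S c d z)"
    define e where "e = (\<Sum>k\<in>S. d k * ?y k)"
    \<comment> \<open>Injectivity of \<open>P\<close>: if \<open>P y = 0\<close>, then
      \<open>y = e c\<close> with \<open>e = d^T y\<close>, and pairing with \<open>d\<close> gives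
      \<open>e = e (d^T c) = 0\<close>.\<close>
    have "e = 0" if "\<forall>i\<in>S. ?y i + c i * e = 0"
    proof -
      have "?y i = e * c i" if "i \<in> S" for i
        using \<open>\<forall>i\<in>S. ?y i + c i * e = 0\<close> that by (metis bit_add_eq_0_iff mult.commute)
      then have "e = (\<Sum>k\<in>S. d k * (e * c k))" by (subst e_def) (rule sum.cong, simp_all)
      also have "\<dots> = e * (\<Sum>j\<in>S. c j * d j)" by (simp only: sum_distrib_left) (simp add: mult_ac)
      finally show ?thesis using cd by simp
    qed
    moreover have "e = 0" if "\<forall>i\<in>S. ?y i = 0" using that by (simp add: e_def)
    ultimately have "(\<forall>i\<in>S. ?y i + c i * e = 0) \<longleftrightarrow> (\<forall>i\<in>S. ?y i = 0)"
      by (metis add.right_neutral mult_zero_right)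
    then show ?thesis
      using s that by (simp add: null_vecs_def mulv_congr[OF sym] flip: e_def)
  qed
  have sh: "shear S c d z \<in> supported S" if "z \<in> supported S" for z
    using that d by (auto simp: supported_def shear_def)
  have "bij_betw (shear S c d) (null_vecs S (congr S c d M)) (null_vecs S M)"
  proof (rule bij_betwI[where g = "shear S c d"])
    show "shear S c d \<in> null_vecs S M \<rightarrow> null_vecs S (congr S c d M)"
      using iff[OF sh] by (auto simp: shear_shear[OF cd] null_vecs_def)
    show "shear S c d \<in> null_vecs S (congr S c d M) \<rightarrow> null_vecs S M"
      using iff by (auto simp: null_vecs_def)
  qed (simp_all add: shear_shear[OF cd])
  then have "nullity S (congr S c d M) = nullity S M"
    using S by (intro nullity_eqI_bij)
  moreover have "nullity S M' = nullity S (congr S c d M)"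
    by (rule nullity_cong) (rule M')
  ultimately show ?thesis by simp
qed

lemma sum_of_bool_mult:
  assumes "finite S" "u \<in> S"
  shows "(\<Sum>j\<in>S. of_bool (j = u) * f j) = (f u :: bit)" "(\<Sum>j\<in>S. f j * of_bool (j = u)) = (f u :: bit)"
proof -
  have "of_bool (j = u) * f j = (if j = u then f j else 0)"
       "f j * of_bool (j = u) = (if j = u then f j else 0)" for j by auto
  then show "(\<Sum>j\<in>S. of_bool (j = u) * f j) = f u" "(\<Sum>j\<in>S. f j * of_bool (j = u)) = f u"
    using assms by (simp_all only: sum.delta if_True)
qed

text \<open>The case where \<open>d\<close> is the unit vector at \<open>u\<close>: row
  \<open>u\<close> times \<open>c i\<close> is added to row \<open>i\<close>, and likewise for
  columns. Orthogonality becomes \<open>c u = 0\<close>.\<close>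

lemma nullity_row_ops:
  assumes S: "finite S" "u \<in> S" and sym: "sym_on S M" and cu: "c u = 0"
    and M': "\<And>i j. i \<in> S \<Longrightarrow> j \<in> S \<Longrightarrow>
      M' i j = M i j + c i * M u j + M i u * c j + c i * c j * M u u"
  shows "nullity S M' = nullity S M"
proof (rule nullity_congr[where c = c and d = "\<lambda>i. of_bool (i = u)", OF S(1) sym])
  have mul: "mulv S M (\<lambda>i. of_bool (i = u)) i = M i u" for i
    unfolding mulv_def using S by (rule sum_of_bool_mult)
  show "M' i j = congr S c (\<lambda>i. of_bool (i = u)) M i j" if "i \<in> S" "j \<in> S" for i j
    using that sym S by (simp add: M' congr_def mul sum_of_bool_mult sym_on_def)
qed (use S cu in \<open>auto simp: sum_of_bool_mult supported_def\<close>)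

section \<open>Columns of the inverse of an invertible matrix\<close>

lemma finite_supported:
  assumes "finite S"
  shows "finite (supported S)"
proof -
  have "finite (UNIV :: bit set)" by (rule card_ge_0_finite) (simp add: card_UNIV_bit_eq)
  then show ?thesis
    by (rule rev_finite_subset[OF finite_set_of_finite_funs[OF assms, of UNIV 0]])
       (auto simp: supported_def)
qed

text \<open>A trivial kernel makes multiplication by \<open>M\<close> injective on a finite set,
  hence surjective.\<close>

lemma exists_mulv_eq:
  assumes S: "finite S" and M: "nullity S M = 0"
  obtains z where "z \<in> supported S" "\<And>k. k \<in> S \<Longrightarrow> mulv S M z k = y k"
proof -
  \<comment> \<open>Values off \<open>S\<close> are set to 0 to obtain a map of
    \<open>supported S\<close> into itself.\<close>
  let ?f = "\<lambda>z k. if k \<in> S then mulv S M z k else 0"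
  have "inj_on ?f (supported S)"
  proof (rule inj_onI)
    fix x y assume xy: "x \<in> supported S" "y \<in> supported S" "?f x = ?f y"
    have "mulv S M x k = mulv S M y k" if "k \<in> S" for k
      using fun_cong[OF xy(3), of k] that by simp
    then have "(\<lambda>i. x i + y i) \<in> null_vecs S M"
      using xy by (auto simp: null_vecs_def mulv_add supported_add)
    then have "(\<lambda>i. x i + y i) = (\<lambda>_. 0)" using M S by (simp add: nullity_eq_0_iff)
    then show "x = y" by (simp add: fun_eq_iff bit_add_eq_0_iff)
  qed
  moreover have "?f ` supported S \<subseteq> supported S" by (auto simp: supported_def)
  ultimately have "?f ` supported S = supported S"
    by (intro endo_inj_surj finite_supported[OF S])
  moreover have "(\<lambda>k. if k \<in> S then y k else 0) \<in> supported S" by (simp add: supported_def)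
  ultimately obtain z where z: "z \<in> supported S" "(\<lambda>k. if k \<in> S then y k else 0) = ?f z" by blast
  have "mulv S M z k = y k" if "k \<in> S" for k
    using fun_cong[OF z(2), of k] that by simp
  with z(1) that show thesis by blast
qed

text \<open>\<open>z\<close> is column \<open>i\<close> of the inverse of \<open>M\<close>, so
  \<open>z i\<close> is the diagonal entry that governs the writhe.\<close>

definition solves_unit :: "nat set \<Rightarrow> (nat \<Rightarrow> nat \<Rightarrow> bit) \<Rightarrow> nat \<Rightarrow> (nat \<Rightarrow> bit) \<Rightarrow> bool" where
  "solves_unit S M i z \<longleftrightarrow> z \<in> supported S \<and> (\<forall>k\<in>S. mulv S M z k = of_bool (k = i))"

text \<open>The inverse of a symmetric matrix is symmetric: evaluate \<open>x^T M y\<close> in both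
  ways.\<close>

lemma solves_unit_commute:
  assumes "finite S" "sym_on S M" "i \<in> S" "j \<in> S" "solves_unit S M i x" "solves_unit S M j y"
  shows "x j = y i"
proof -
  have "(\<Sum>k\<in>S. x k * mulv S M y k) = (\<Sum>k\<in>S. y k * mulv S M x k)"
    by (rule sum_mulv_commute[OF assms(2)])
  then show ?thesis
    using assms by (simp add: solves_unit_def sum_of_bool_mult)
qed

definition flip_diag :: "(nat \<Rightarrow> nat \<Rightarrow> bit) \<Rightarrow> nat \<Rightarrow> nat \<Rightarrow> nat \<Rightarrow> bit" where
  "flip_diag M i k l = M k l + of_bool (k = i \<and> l = i)"

lemma mulv_flip_diag:
  assumes "finite S" "i \<in> S"
  shows "mulv S (flip_diag M i) z k = mulv S M z k + of_bool (k = i) * z i"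
proof -
  have "flip_diag M i k j * z j = M k j * z j + of_bool (j = i) * (of_bool (k = i) * z j)" for j
    by (cases "k = i"; cases "j = i") (simp_all add: flip_diag_def distrib_right)
  then show ?thesis using assms by (simp add: mulv_def sum.distrib sum_of_bool_mult)
qed

text \<open>If \<open>M z = e\<^sub>i\<close>, the kernel of \<open>M + E\<^sub>i\<^sub>i\<close> is \<open>{0, z}\<close> if \<open>z i = 1\<close> and trivial otherwise.\<close>

lemma nullity_flip_diag:
  assumes S: "finite S" "i \<in> S" and M: "nullity S M = 0" and z: "solves_unit S M i z"
  shows "nullity S (flip_diag M i) = of_bool (z i = 1)"
proof -
  have "x \<in> null_vecs S (flip_diag M i) \<longleftrightarrow> x = (\<lambda>_. 0) \<or> z i = 1 \<and> x = z" for x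
  proof
    assume x: "x \<in> null_vecs S (flip_diag M i)"
    then have xs: "x \<in> supported S" "\<And>k. k \<in> S \<Longrightarrow> mulv S M x k = of_bool (k = i) * x i"
      unfolding null_vecs_def mulv_flip_diag[OF S] bit_add_eq_0_iff by blast+
    \<comment> \<open>A kernel vector satisfies \<open>M x = x i e_i\<close>, and \<open>x i\<close>
      times \<open>z\<close> has the same image under \<open>M\<close>.\<close>
    have "mulv S M (\<lambda>k. x k + x i * z k) k = 0" if "k \<in> S" for k
      using that z xs(2)[OF that] by (simp add: mulv_add mulv_scale solves_unit_def mult.commute)
    moreover have "(\<lambda>k. x k + x i * z k) \<in> supported S"
      using xs(1) z by (simp add: supported_def solves_unit_def)
    ultimately have "(\<lambda>k. x k + x i * z k) \<in> null_vecs S M"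
      by (simp add: null_vecs_def)
    then have "(\<lambda>k. x k + x i * z k) = (\<lambda>_. 0)" using M S by (simp add: nullity_eq_0_iff)
    then have xk: "x k = x i * z k" for k
      by (metis bit_add_eq_0_iff)
    show "x = (\<lambda>_. 0) \<or> z i = 1 \<and> x = z"
    proof (cases "x i = 0")
      case True
      then have "x k = 0" for k using xk[of k] by simp
      then show ?thesis by auto
    next
      case False
      then have "x i = 1" by simp
      then have "x k = z k" for k using xk[of k] by simp
      then have "x = z" by auto
      then show ?thesis using \<open>x i = 1\<close> by simp
    qed
  next
    have "(\<lambda>_. 0) \<in> null_vecs S (flip_diag M i)"
      by (simp add: null_vecs_def supported_def mulv_def)
    moreover have "z \<in> null_vecs S (flip_diag M i)" if "z i = 1"
      using z that by (simp add: null_vecs_def solves_unit_def mulv_flip_diag[OF S])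
    moreover assume "x = (\<lambda>_. 0) \<or> z i = 1 \<and> x = z"
    ultimately show "x \<in> null_vecs S (flip_diag M i)" by blast
  qed
  then have nv: "null_vecs S (flip_diag M i) = {x. x = (\<lambda>_. 0) \<or> z i = 1 \<and> x = z}" by blast
  have "card (null_vecs S (flip_diag M i)) = 2 ^ of_bool (z i = 1)"
  proof (cases "z i = 1")
    case True
    then have "z \<noteq> (\<lambda>_. 0)" by auto
    moreover have "null_vecs S (flip_diag M i) = {\<lambda>_. 0, z}" unfolding nv using True by blast
    ultimately show ?thesis using True by simp
  next
    case False
    then have "null_vecs S (flip_diag M i) = {\<lambda>_. 0}" unfolding nv by blast
    then show ?thesis using False by simp
  qed
  then show ?thesis using S by (simp add: card_null_vecs)
qed

text \<open>Solving \<open>P M P^T y = e_i\<close> means \<open>M (P^T y) = P^-1 e_i\<close>. As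
  \<open>P\<close> is its own inverse, the right-hand side is \<open>e_i + d i c\<close>; this is
  the condition on \<open>x\<close>, and \<open>shear\<close> turns \<open>x\<close> back into
  \<open>y\<close>.\<close>

lemma solves_unit_congr:
  assumes sym: "sym_on S M" and cd: "(\<Sum>j\<in>S. c j * d j) = 0" and d: "d \<in> supported S"
    and M': "\<And>i j. i \<in> S \<Longrightarrow> j \<in> S \<Longrightarrow> M' i j = congr S c d M i j"
    and x: "x \<in> supported S" "\<And>k. k \<in> S \<Longrightarrow> mulv S M x k = of_bool (k = i) + d i * c k"
    and i: "finite S" "i \<in> S"
  shows "solves_unit S M' i (shear S c d x)"
proof -
  have sum: "(\<Sum>k\<in>S. d k * mulv S M x k) = d i"
  proof -
    have "(\<Sum>k\<in>S. d k * mulv S M x k) = (\<Sum>k\<in>S. d k * of_bool (k = i) + d i * (c k * d k))"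
      by (intro sum.cong) (simp_all add: x distrib_left mult_ac)
    also have "\<dots> = d i"
      using i cd by (simp add: sum.distrib sum_of_bool_mult flip: sum_distrib_left)
    finally show ?thesis .
  qed
  have "mulv S M' (shear S c d x) k = of_bool (k = i)" if "k \<in> S" for k
  proof -
    have "mulv S M' (shear S c d x) k = mulv S (congr S c d M) (shear S c d x) k"
      using that by (intro mulv_cong) (simp add: M')
    also have "\<dots> = of_bool (k = i) + d i * c k + c k * d i"
      unfolding mulv_congr[OF sym] shear_shear[OF cd] sum using that by (simp add: x)
    finally show ?thesis by (simp add: mult_ac add.assoc)
  qed
  moreover have "shear S c d x \<in> supported S" using x d by (auto simp: supported_def shear_def)
  ultimately show ?thesis by (simp add: solves_unit_def)
qed

section \<open>Bracket and writhe as sums over vertex sets\<close>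

lemma labeled_graphD:
  assumes "labeled_graph G"
  shows labeled_graph_finite: "finite (verts G)"
    and labeled_graph_adj_verts: "adj G x y \<Longrightarrow> x \<in> verts G \<and> y \<in> verts G"
    and labeled_graph_adj_sym: "adj G x y \<longleftrightarrow> adj G y x"
    and labeled_graph_adj_irrefl: "\<not> adj G x x"
    and labeled_graph_lab: "x \<in> verts G \<Longrightarrow> lab G x = 1 \<or> lab G x = - 1"
  using assms unfolding labeled_graph_def by blast+

definition adj_bit :: "lgraph \<Rightarrow> nat \<Rightarrow> nat \<Rightarrow> bit" where
  "adj_bit G i j = of_bool (adj G i j)"

definition adj_plus_id :: "lgraph \<Rightarrow> nat \<Rightarrow> nat \<Rightarrow> bit" where
  "adj_plus_id G i j = of_bool (adj G i j) + of_bool (i = j)"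

lemma corank_adj_mat_induced:
  "corank (adj_mat (induced G s)) = nullity s (adj_bit G)"
proof -
  have "adj_mat (induced G s) = mat_on s (adj_bit (induced G s))"
    by (simp add: adj_mat_def mat_on_def adj_bit_def order_of_def vlist_def induced_def)
  moreover have "nullity s (adj_bit (induced G s)) = nullity s (adj_bit G)"
    by (rule nullity_cong) (simp add: adj_bit_def induced_def)
  ultimately show ?thesis by (simp add: nullity_def)
qed

context
  fixes G :: lgraph
  assumes fin: "finite (verts G)"
begin

lemma vlist_inj:
  assumes "i < order_of G" "j < order_of G"
  shows "vlist G ! i = vlist G ! j \<longleftrightarrow> i = j"
  using assms fin by (simp add: nth_eq_iff_index_eq order_of_def vlist_def)

lemma corank_adj_mat_plus_one:
  "corank (adj_mat G + 1\<^sub>m (order_of G)) = nullity (verts G) (adj_plus_id G)"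
proof -
  have "adj_mat G + 1\<^sub>m (order_of G) = mat_on (verts G) (adj_plus_id G)"
    by (rule eq_matI)
       (auto simp: adj_mat_def mat_on_def adj_plus_id_def vlist_inj simp flip: order_of_def vlist_def)
  then show ?thesis by (simp add: nullity_def)
qed

lemma corank_B_mat:
  assumes "i < order_of G"
  shows "corank (B_mat G i) = nullity (verts G) (flip_diag (adj_plus_id G) (vlist G ! i))"
proof -
  have "B_mat G i = mat_on (verts G) (flip_diag (adj_plus_id G) (vlist G ! i))"
    by (rule eq_matI)
       (use assms in \<open>auto simp: B_mat_def unit_diag_mat_def adj_mat_def mat_on_def adj_plus_id_def flip_diag_def
         vlist_inj simp flip: order_of_def vlist_def\<close>)
  then show ?thesis by (simp add: nullity_def)
qed

lemma writhe_eq_sum: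
  "writhe G = (\<Sum>x\<in>verts G. (- 1) ^ nullity (verts G) (flip_diag (adj_plus_id G) x) * lab G x)"
proof -
  have "writhe G = (\<Sum>i<order_of G.
      (\<lambda>x. (- 1) ^ nullity (verts G) (flip_diag (adj_plus_id G) x) * lab G x) (vlist G ! i))"
    by (simp add: writhe_def corank_B_mat)
  also have "\<dots> = (\<Sum>x\<in>verts G. (- 1) ^ nullity (verts G) (flip_diag (adj_plus_id G) x) * lab G x)"
    using sum_nth_sorted_list[OF fin, of "\<lambda>x. (- 1) ^ nullity (verts G) (flip_diag (adj_plus_id G) x) * lab G x"]
    by (simp add: order_of_def vlist_def)
  finally show ?thesis .
qed

end

section \<open>State sums and the splitting off of vertices\<close>

text \<open>The exponent \<open>alpha - beta\<close> as a sum over vertices: a vertex counted by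
  \<open>alpha\<close> contributes 1 and any other -1, which is the label outside the state and its
  negative inside.\<close>

definition weight :: "nat set \<Rightarrow> (nat \<Rightarrow> int) \<Rightarrow> nat set \<Rightarrow> int" where
  "weight W l s = (\<Sum>v\<in>W. if v \<in> s then - l v else l v)"

text \<open>The function \<open>f\<close> is left arbitrary so that the part of the sum over states
  containing a given vertex is again a state sum, over a smaller vertex set.\<close>

definition state_sum :: "'a::field \<Rightarrow> nat set \<Rightarrow> (nat \<Rightarrow> int) \<Rightarrow> (nat set \<Rightarrow> 'a) \<Rightarrow> 'a" where
  "state_sum a W l f = (\<Sum>s\<in>Pow W. a powi weight W l s * f s)"

definition loop_val :: "'a::field \<Rightarrow> 'a" where
  "loop_val a = - (a powi 2) - a powi (- 2)"

lemma weight_eq: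
  assumes "labeled_graph G" "s \<subseteq> verts G"
  shows "state_alpha G s - state_beta G s = weight (verts G) (lab G) s"
proof -
  have fin: "finite (verts G)" and lab: "\<And>x. x \<in> verts G \<Longrightarrow> lab G x = 1 \<or> lab G x = - 1"
    using labeled_graph_finite labeled_graph_lab assms(1) by auto
  have "{v \<in> s. lab G v = - 1} = {v \<in> verts G. v \<in> s \<and> lab G v = - 1}"
    and "{v \<in> verts G - s. lab G v = 1} = {v \<in> verts G. v \<notin> s \<and> lab G v = 1}"
    using assms by auto
  then have "state_alpha G s =
      (\<Sum>v\<in>verts G. of_bool (v \<in> s \<and> lab G v = - 1)) + (\<Sum>v\<in>verts G. of_bool (v \<notin> s \<and> lab G v = 1))"
    using fin by (simp add: state_alpha_def of_bool_def sum.If_cases Int_def)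
  \<comment> \<open>\<open>alpha - beta = 2 alpha - n\<close>, with \<open>n\<close> distributed as
    one per vertex.\<close>
  then have "state_alpha G s - state_beta G s =
     (\<Sum>v\<in>verts G. 2 * of_bool (v \<in> s \<and> lab G v = - 1) + 2 * of_bool (v \<notin> s \<and> lab G v = 1) - 1)"
    by (simp add: state_beta_def order_of_def sum.distrib sum_subtractf flip: sum_distrib_left)
  also have "\<dots> = weight (verts G) (lab G) s"
    unfolding weight_def by (rule sum.cong) (use lab in force)+
  finally show ?thesis .
qed

lemma kauffman_bracket_eq:
  assumes "labeled_graph G"
  shows "kauffman_bracket G = state_sum fls_X (verts G) (lab G) (\<lambda>s. loop_val fls_X ^ nullity s (adj_bit G))"
  unfolding kauffman_bracket_def state_sum_def loop_val_def
  by (rule sum.cong) (simp_all add: weight_eq[OF assms] corank_adj_mat_induced)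

lemma state_sum_cong:
  assumes "\<And>v. v \<in> W \<Longrightarrow> l v = l' v" "\<And>s. s \<subseteq> W \<Longrightarrow> f s = f' s"
  shows "state_sum a W l f = state_sum a W l' f'"
proof -
  have "weight W l s = weight W l' s" for s
    unfolding weight_def by (rule sum.cong) (simp_all add: assms)
  then show ?thesis unfolding state_sum_def by (intro sum.cong) (simp_all add: assms)
qed

lemma state_sum_scale: "state_sum a W l (\<lambda>s. c * f s) = c * state_sum a W l f"
  by (simp add: state_sum_def sum_distrib_left mult_ac)

text \<open>The states are divided into those avoiding \<open>x\<close> and those containing
  it.\<close>

lemma state_sum_insert:
  assumes W: "finite W" "x \<notin> W" and a: "a \<noteq> 0"
  shows "state_sum a (insert x W) l f =
     a powi l x * state_sum a W l f + a powi (- l x) * state_sum a W l (\<lambda>s. f (insert x s))"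
proof -
  have w: "weight (insert x W) l s = l x + weight W l s" "weight (insert x W) l (insert x s) = - l x + weight W l s"
    if "s \<in> Pow W" for s
  proof -
    have "weight W l (insert x s) = weight W l s"
      unfolding weight_def using W by (intro sum.cong) auto
    then show "weight (insert x W) l s = l x + weight W l s"
        "weight (insert x W) l (insert x s) = - l x + weight W l s"
      using W that by (auto simp: weight_def)
  qed
  have "state_sum a (insert x W) l f = (\<Sum>s\<in>Pow W. a powi weight (insert x W) l s * f s)
      + (\<Sum>s\<in>insert x ` Pow W. a powi weight (insert x W) l s * f s)"
    unfolding state_sum_def Pow_insert using W by (intro sum.union_disjoint) auto
  also have "(\<Sum>s\<in>insert x ` Pow W. a powi weight (insert x W) l s * f s) =
      (\<Sum>s\<in>Pow W. a powi weight (insert x W) l (insert x s) * f (insert x s))"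
    by (subst sum.reindex) (use W in \<open>auto intro!: inj_onI\<close>)
  finally show ?thesis
    by (simp add: w[THEN arg_cong[where f = "power_int a"], unfolded power_int_add[OF disjI1[OF a]]]
      state_sum_def sum_distrib_left mult.assoc)
qed

lemma state_sum_insert2:
  assumes "finite W" "x \<notin> W" "y \<notin> W" "x \<noteq> y" "a \<noteq> 0"
  shows "state_sum a (insert x (insert y W)) l f =
     a powi l x * (a powi l y * state_sum a W l f + a powi (- l y) * state_sum a W l (\<lambda>s. f (insert y s)))
   + a powi (- l x) * (a powi l y * state_sum a W l (\<lambda>s. f (insert x s))
      + a powi (- l y) * state_sum a W l (\<lambda>s. f (insert x (insert y s))))"
  using assms by (simp add: state_sum_insert)

lemma state_sum_insert3:
  assumes "finite W" "x \<notin> W" "y \<notin> W" "z \<notin> W" "x \<noteq> y" "x \<noteq> z" "y \<noteq> z" "a \<noteq> 0"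
  shows "state_sum a (insert x (insert y (insert z W))) l f =
     a powi l x * (a powi l y * (a powi l z * state_sum a W l f
          + a powi (- l z) * state_sum a W l (\<lambda>s. f (insert z s)))
        + a powi (- l y) * (a powi l z * state_sum a W l (\<lambda>s. f (insert y s))
          + a powi (- l z) * state_sum a W l (\<lambda>s. f (insert y (insert z s)))))
   + a powi (- l x) * (a powi l y * (a powi l z * state_sum a W l (\<lambda>s. f (insert x s))
          + a powi (- l z) * state_sum a W l (\<lambda>s. f (insert x (insert z s))))
        + a powi (- l y) * (a powi l z * state_sum a W l (\<lambda>s. f (insert x (insert y s)))
          + a powi (- l z) * state_sum a W l (\<lambda>s. f (insert x (insert y (insert z s))))))"
  using assms by (simp add: state_sum_insert)

section \<open>Invariance under isomorphism\<close>

definition vertex_iso :: "(nat \<Rightarrow> nat) \<Rightarrow> lgraph \<Rightarrow> lgraph \<Rightarrow> bool" where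
  "vertex_iso f G H \<longleftrightarrow> bij_betw f (verts G) (verts H) \<and>
          (\<forall>x \<in> verts G. lab H (f x) = lab G x) \<and>
          (\<forall>x \<in> verts G. \<forall>y \<in> verts G. adj H (f x) (f y) \<longleftrightarrow> adj G x y)"

lemma kauffman_bracket_iso:
  assumes G: "labeled_graph G" and H: "labeled_graph H" and f: "vertex_iso f G H"
  shows "kauffman_bracket G = kauffman_bracket H"
proof -
  have b: "bij_betw f (verts G) (verts H)" and l: "\<And>x. x \<in> verts G \<Longrightarrow> lab H (f x) = lab G x"
    and a: "\<And>x y. x \<in> verts G \<Longrightarrow> y \<in> verts G \<Longrightarrow> adj H (f x) (f y) \<longleftrightarrow> adj G x y"
    using f by (auto simp: vertex_iso_def)
  have fin: "finite (verts G)" by (rule labeled_graph_finite[OF G])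
  have inj: "inj_on f (verts G)" using b by (simp add: bij_betw_def)
  have w: "weight (verts H) (lab H) (f ` s) = weight (verts G) (lab G) s" if "s \<subseteq> verts G" for s
  proof -
    have "weight (verts H) (lab H) (f ` s) =
      (\<Sum>v\<in>verts G. if f v \<in> f ` s then - lab H (f v) else lab H (f v))"
      unfolding weight_def by (rule sum.reindex_bij_betw[OF b, symmetric])
    also have "\<dots> = weight (verts G) (lab G) s"
      unfolding weight_def using that inj
      by (intro sum.cong) (auto simp: l inj_on_image_mem_iff)
    finally show ?thesis .
  qed
  have n: "nullity (f ` s) (adj_bit H) = nullity s (adj_bit G)" if "s \<subseteq> verts G" for s
    using that fin inj
    by (intro nullity_iso[where f = f]) (auto simp: adj_bit_def a subset_iff bij_betw_def intro: finite_subset inj_on_subset)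
  have "bij_betw ((`) f) (Pow (verts G)) (Pow (verts H))" using b by (rule bij_betw_Pow)
  from sum.reindex_bij_betw[OF this, of "\<lambda>s. fls_X powi weight (verts H) (lab H) s * loop_val fls_X ^ nullity s (adj_bit H)"]
  show ?thesis
    by (simp add: kauffman_bracket_eq G H state_sum_def w n)
qed

lemma adj_plus_id_iso:
  assumes "vertex_iso f G H" "x \<in> verts G" "y \<in> verts G"
  shows "adj_plus_id H (f x) (f y) = adj_plus_id G x y"
proof -
  have "f x = f y \<longleftrightarrow> x = y" using assms by (auto simp: vertex_iso_def bij_betw_def inj_on_def)
  then show ?thesis using assms by (simp add: vertex_iso_def adj_plus_id_def)
qed

lemma nullity_flip_diag_iso:
  assumes fin: "finite (verts G)" and f: "vertex_iso f G H" and x: "x \<in> verts G"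
  shows "nullity (verts H) (flip_diag (adj_plus_id H) (f x)) = nullity (verts G) (flip_diag (adj_plus_id G) x)"
proof (rule nullity_iso[OF fin])
  show "bij_betw f (verts G) (verts H)" using f by (simp add: vertex_iso_def)
  then have "f y = f z \<longleftrightarrow> y = z" if "y \<in> verts G" "z \<in> verts G" for y z
    using that by (auto simp: bij_betw_def inj_on_def)
  then show "flip_diag (adj_plus_id H) (f x) (f i) (f j) = flip_diag (adj_plus_id G) x i j"
    if "i \<in> verts G" "j \<in> verts G" for i j
    using that x by (simp add: flip_diag_def adj_plus_id_iso[OF f])
qed

lemma writhe_iso:
  assumes G: "labeled_graph G" and H: "labeled_graph H" and f: "vertex_iso f G H"
  shows "writhe G = writhe H"
proof -
  have fin: "finite (verts G)" "finite (verts H)" using G H by (simp_all add: labeled_graph_finite)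
  have b: "bij_betw f (verts G) (verts H)" and l: "\<And>x. x \<in> verts G \<Longrightarrow> lab H (f x) = lab G x"
    using f by (auto simp: vertex_iso_def)
  show ?thesis
    using sum.reindex_bij_betw[OF b, of "\<lambda>x. (- 1) ^ nullity (verts H) (flip_diag (adj_plus_id H) x) * lab H x"]
    by (simp add: writhe_eq_sum fin l nullity_flip_diag_iso[OF fin(1) f])
qed

lemma jones_iso:
  assumes "labeled_graph G" "labeled_graph H" "lgraph_iso G H"
  shows "jones G = jones H"
proof -
  obtain f where "vertex_iso f G H" using assms by (auto simp: lgraph_iso_def vertex_iso_def)
  then show ?thesis
    using assms by (simp add: jones_def kauffman_bracket_iso[of G H f] writhe_iso[of G H f])
qed

section \<open>The first and second moves\<close>

lemma sym_on_adj_bit: "labeled_graph G \<Longrightarrow> sym_on S (adj_bit G)"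
  using labeled_graph_adj_sym by (auto simp: sym_on_def adj_bit_def)

lemma sym_on_adj_plus_id: "labeled_graph G \<Longrightarrow> sym_on S (adj_plus_id G)"
  using labeled_graph_adj_sym by (auto simp: sym_on_def adj_plus_id_def)

lemma sym_on_flip_diag: "sym_on S M \<Longrightarrow> sym_on S (flip_diag M i)"
  by (auto simp: sym_on_def flip_diag_def)

text \<open>Adding row and column \<open>x\<close> to those of \<open>y\<close> clears
  \<open>y\<close> completely, diagonal included, and an isolated vertex with diagonal entry 0
  remains.\<close>

lemma nullity_equal_rows:
  assumes S: "finite S" "x \<notin> S" "y \<notin> S" "x \<noteq> y"
    and sym: "sym_on (insert x (insert y S)) M"
    and eq: "\<And>t. t \<in> S \<Longrightarrow> M y t = M x t" "M y y = M x x" "M x y = M x x"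
  shows "nullity (insert x (insert y S)) M = Suc (nullity (insert x S) M)"
proof -
  define c where "c = (\<lambda>i. of_bool (i = y) :: bit)"
  define M' where "M' = (\<lambda>i j. M i j + c i * M x j + M i x * c j + c i * c j * M x x)"
  have s: "M i j = M j i" if "i \<in> insert x (insert y S)" "j \<in> insert x (insert y S)" for i j
    using sym that by (auto simp: sym_on_def)
  have "nullity (insert x (insert y S)) M = nullity (insert x (insert y S)) M'"
    by (rule nullity_row_ops[symmetric, where u = x and c = c])
       (use S sym in \<open>auto simp: c_def M'_def\<close>)
  also have "\<dots> = nullity (insert y (insert x S)) M'" by (simp add: insert_commute)
  also have "\<dots> = Suc (nullity (insert x S) M')"
  proof -
    have "M' y j = 0 \<and> M' j y = 0" if "j \<in> insert x S" for j
      using that S eq s[of j y] s[of j x] s[of x y] by (auto simp: M'_def c_def)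
    moreover have "M' y y = 0"
      using S eq s[of x y] by (simp add: M'_def c_def)
    ultimately show ?thesis
      using nullity_insert_isolated[of "insert x S" y M'] S by simp
  qed
  also have "nullity (insert x S) M' = nullity (insert x S) M"
    by (rule nullity_cong) (use S in \<open>auto simp: M'_def c_def\<close>)
  finally show ?thesis .
qed

text \<open>The version of the twin argument for \<open>A + E\<close>: the diagonal ones differ from
  \<open>M x y = 0\<close>, so after adding row and column \<open>x\<close> the vertex
  \<open>y\<close> is pendant at \<open>x\<close>, and both are eliminated.\<close>

lemma nullity_nonadjacent_twins:
  assumes S: "finite S" "x \<notin> S" "y \<notin> S" "x \<noteq> y"
    and sym: "sym_on (insert x (insert y S)) M"
    and eq: "\<And>t. t \<in> S \<Longrightarrow> M y t = M x t" "M x x = 1" "M y y = 1" "M x y = 0"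
  shows "nullity (insert x (insert y S)) M = nullity S M"
proof -
  define c where "c = (\<lambda>i. of_bool (i = y) :: bit)"
  define M' where "M' = (\<lambda>i j. M i j + c i * M x j + M i x * c j + c i * c j * M x x)"
  have s: "M i j = M j i" if "i \<in> insert x (insert y S)" "j \<in> insert x (insert y S)" for i j
    using sym that by (auto simp: sym_on_def)
  have "nullity (insert x (insert y S)) M = nullity (insert x (insert y S)) M'"
    by (rule nullity_row_ops[symmetric, where u = x and c = c])
       (use S sym in \<open>auto simp: c_def M'_def\<close>)
  also have "\<dots> = nullity S M'"
  proof (rule nullity_insert_pendant)
    show "M' y j = 0 \<and> M' j y = 0" if "j \<in> S" for j
      using that S eq s[of j y] s[of j x] by (auto simp: M'_def c_def)
    show "M' y y = 0" "M' x y = 1" "M' y x = 1"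
      using S eq s[of x y] by (simp_all add: M'_def c_def)
  qed (use S in auto)
  also have "nullity S M' = nullity S M"
    by (rule nullity_cong) (use S in \<open>auto simp: M'_def c_def\<close>)
  finally show ?thesis .
qed

definition knot_like :: "lgraph \<Rightarrow> bool" where
  "knot_like G \<longleftrightarrow> nullity (verts G) (adj_plus_id G) = 0"

lemma agree_on_adj_bit: "agree_on V G H \<Longrightarrow> i \<in> V \<Longrightarrow> j \<in> V \<Longrightarrow> adj_bit H i j = adj_bit G i j"
  and agree_on_adj_plus_id: "agree_on V G H \<Longrightarrow> i \<in> V \<Longrightarrow> j \<in> V \<Longrightarrow> adj_plus_id H i j = adj_plus_id G i j"
  and agree_on_lab: "agree_on V G H \<Longrightarrow> i \<in> V \<Longrightarrow> lab H i = lab G i"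
  by (auto simp: agree_on_def adj_bit_def adj_plus_id_def)

lemma agree_on_nullity_adj_bit: "agree_on V G H \<Longrightarrow> s \<subseteq> V \<Longrightarrow> nullity s (adj_bit H) = nullity s (adj_bit G)"
  by (rule nullity_cong) (auto intro: agree_on_adj_bit)

lemma agree_on_nullity_flip_diag:
  "agree_on V G H \<Longrightarrow> nullity V (flip_diag (adj_plus_id H) i) = nullity V (flip_diag (adj_plus_id G) i)"
  by (rule nullity_cong) (auto simp: flip_diag_def intro: agree_on_adj_plus_id)

text \<open>With \<open>e\<close> the sign of an isolated vertex, the bracket factor is
  \<open>a^e + a^(-e) (- a^2 - a^-2) = - a^(-3e)\<close>, the classical factor of a kink.\<close>

lemma kink_factor:
  fixes a :: "'a::field"
  assumes "a \<noteq> 0" "e = 1 \<or> e = - 1"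
  shows "(- a) powi (3 * e) * (a powi e + a powi (- e) * loop_val a) = 1"
  using assms by (auto simp: loop_val_def power_int_minus field_simps power2_eq_square power3_eq_cube)

lemma jones_omega1:
  assumes G: "labeled_graph G" and H: "labeled_graph H" and om: "omega1 G H" and K: "knot_like G"
  shows "jones H = jones G"
proof -
  from om obtain x where x: "x \<notin> verts G" "verts H = insert x (verts G)"
    and ag: "agree_on (verts G) G H" and nb: "nbhd H x = {}"
    unfolding omega1_def by blast
  have fin: "finite (verts G)" by (rule labeled_graph_finite[OF G])
  have iso: "\<not> adj H x j" "\<not> adj H j x" for j
    using nb H unfolding nbhd_def labeled_graph_def by blast+
  define e where "e = lab H x"
  have e: "e = 1 \<or> e = - 1" unfolding e_def by (rule labeled_graph_lab[OF H]) (simp add: x)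
  have X: "(fls_X :: rat fls) \<noteq> 0" by simp
  have ins: "nullity (insert x s) (adj_bit H) = Suc (nullity s (adj_bit G))" if "s \<subseteq> verts G" for s
    using nullity_insert_isolated[of s x "adj_bit H"] that fin x iso agree_on_nullity_adj_bit[OF ag that]
    by (auto simp: adj_bit_def intro: finite_subset)
  have "kauffman_bracket H = fls_X powi e * kauffman_bracket G
      + fls_X powi (- e) * state_sum fls_X (verts G) (lab H) (\<lambda>s. loop_val fls_X ^ nullity (insert x s) (adj_bit H))"
    unfolding kauffman_bracket_eq[OF H] kauffman_bracket_eq[OF G] x(2) state_sum_insert[OF fin x(1) X] e_def
    by (simp add: agree_on_nullity_adj_bit[OF ag] agree_on_lab[OF ag] cong: state_sum_cong)
  also have "state_sum fls_X (verts G) (lab H) (\<lambda>s. loop_val fls_X ^ nullity (insert x s) (adj_bit H)) =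
     state_sum fls_X (verts G) (lab G) (\<lambda>s. loop_val fls_X * loop_val fls_X ^ nullity s (adj_bit G))"
    by (rule state_sum_cong) (simp_all add: ins agree_on_lab[OF ag])
  finally have br: "kauffman_bracket H =
      (fls_X powi e + fls_X powi (- e) * loop_val fls_X) * kauffman_bracket G"
    unfolding state_sum_scale kauffman_bracket_eq[OF G] by (simp only: distrib_right mult.assoc)
  \<comment> \<open>Adding \<open>E_xx\<close> makes row \<open>x\<close> zero while the rest is the
    invertible matrix of \<open>G\<close>. The corank is thus 1, and \<open>x\<close> contributes
    the negative of its sign.\<close>
  have nx: "nullity (verts H) (flip_diag (adj_plus_id H) x) = 1"
    using nullity_insert_isolated[of "verts G" x "flip_diag (adj_plus_id H) x"] K x fin iso
      agree_on_nullity_flip_diag[OF ag, of x] nullity_cong[of "verts G" "flip_diag (adj_plus_id G) x" "adj_plus_id G"]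
    by (auto simp: flip_diag_def adj_plus_id_def knot_like_def)
  have ni: "nullity (verts H) (flip_diag (adj_plus_id H) i) = nullity (verts G) (flip_diag (adj_plus_id G) i)"
    if i: "i \<in> verts G" for i
  proof -
    have "x \<noteq> i" using i x by auto
    then have "flip_diag (adj_plus_id H) i x j = 0 \<and> flip_diag (adj_plus_id H) i j x = 0" if "j \<in> verts G" for j
      using that x iso by (auto simp: flip_diag_def adj_plus_id_def)
    moreover have "flip_diag (adj_plus_id H) i x x = 1"
      using \<open>x \<noteq> i\<close> iso by (simp add: flip_diag_def adj_plus_id_def)
    ultimately show ?thesis
      using nullity_insert_isolated[OF fin x(1), of "flip_diag (adj_plus_id H) i"]
        agree_on_nullity_flip_diag[OF ag, of i] x(2) by simp
  qed
  have "writhe H = writhe G - e"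
    using fin x by (simp add: writhe_eq_sum nx[unfolded x(2)] ni[unfolded x(2)] e_def agree_on_lab[OF ag])
  then have "- 3 * writhe H = - 3 * writhe G + 3 * e" by simp
  then have w: "(- fls_X) powi (- 3 * writhe H) = (- fls_X) powi (- 3 * writhe G) * (- fls_X :: rat fls) powi (3 * e)"
    by (simp only:) (rule power_int_add, simp)
  show ?thesis
    unfolding jones_def w br
    by (simp only: mult.assoc) (simp only: kink_factor[OF X e] mult.assoc[symmetric] mult_1_right)
qed


text \<open>\<open>p\<close> collects the states avoiding both twins and \<open>q\<close> those with
  exactly one given twin; the coefficient of \<open>q\<close> is
  \<open>a^(2e) + a^(-2e) - a^2 - a^-2 = 0\<close>.\<close>

lemma twin_factor:
  fixes a :: "'a::field"
  assumes "a \<noteq> 0" "e = 1 \<or> e = - 1"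
  shows "a powi e * (a powi (- e) * p + a powi e * q) + a powi (- e) * (a powi (- e) * q + a powi e * (loop_val a * q)) = p"
  using assms by (auto simp: loop_val_def power_int_minus field_simps power2_eq_square)

lemma jones_omega2:
  assumes G: "labeled_graph G" and H: "labeled_graph H" and om: "omega2 G H"
  shows "jones H = jones G"
proof -
  from om obtain x y where xy: "x \<noteq> y" "x \<notin> verts G" "y \<notin> verts G"
    and V: "verts H = insert x (insert y (verts G))" and ag: "agree_on (verts G) G H"
    and nadj: "\<not> adj H x y" and lab: "lab H x = - lab H y"
    and twin: "\<And>t. t \<in> verts G \<Longrightarrow> adj H y t \<longleftrightarrow> adj H x t"
    unfolding omega2_def by auto
  have fin: "finite (verts G)" by (rule labeled_graph_finite[OF G])
  have sy: "adj H i j \<longleftrightarrow> adj H j i" and irr: "\<not> adj H i i" for i j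
    by (rule labeled_graph_adj_sym[OF H], rule labeled_graph_adj_irrefl[OF H])
  define e where "e = lab H x"
  have e: "e = 1 \<or> e = - 1" unfolding e_def by (rule labeled_graph_lab[OF H]) (simp add: V)
  have laby: "lab H y = - lab H x" using lab by simp
  have X: "(fls_X :: rat fls) \<noteq> 0" by simp
  have nxy: "nullity (insert x (insert y s)) (adj_bit H) = Suc (nullity (insert x s) (adj_bit H))" if "s \<subseteq> verts G" for s
    by (rule nullity_equal_rows)
       (use that xy fin nadj irr twin sym_on_adj_bit[OF H] in \<open>auto simp: adj_bit_def intro: finite_subset\<close>)
  have ny: "nullity (insert y s) (adj_bit H) = nullity (insert x s) (adj_bit H)" if "s \<subseteq> verts G" for s
  proof (rule nullity_iso[where f = "\<lambda>i. if i = x then y else i"])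
    show "finite (insert x s)" using that fin finite_subset by auto
    show "bij_betw (\<lambda>i. if i = x then y else i) (insert x s) (insert y s)"
      using that xy by (auto simp: bij_betw_def inj_on_def)
    show "adj_bit H (if i = x then y else i) (if j = x then y else j) = adj_bit H i j"
      if "i \<in> insert x s" "j \<in> insert x s" for i j
      using that \<open>s \<subseteq> verts G\<close> xy twin sy[of i] by (auto simp: adj_bit_def irr)
  qed
  let ?F = "\<lambda>f. state_sum fls_X (verts G) (lab G) (\<lambda>s. loop_val fls_X ^ nullity (f s) (adj_bit H) :: rat fls)"
  have c: "state_sum fls_X (verts G) (lab H) f = state_sum fls_X (verts G) (lab G) f" for f :: "nat set \<Rightarrow> rat fls"
    by (rule state_sum_cong) (simp_all add: agree_on_lab[OF ag])
  have "kauffman_bracket H =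
      fls_X powi e * (fls_X powi (- e) * ?F (\<lambda>s. s) + fls_X powi e * ?F (insert y)) +
      fls_X powi (- e) * (fls_X powi (- e) * ?F (insert x) + fls_X powi e * ?F (\<lambda>s. insert x (insert y s)))"
    unfolding kauffman_bracket_eq[OF H] V state_sum_insert2[OF fin xy(2,3,1) X] c laby minus_minus e_def ..
  also have "?F (\<lambda>s. s) = kauffman_bracket G"
    unfolding kauffman_bracket_eq[OF G] by (rule state_sum_cong) (simp_all add: agree_on_nullity_adj_bit[OF ag])
  also have "?F (insert y) = ?F (insert x)"
    by (rule state_sum_cong) (simp_all add: ny)
  also have "?F (\<lambda>s. insert x (insert y s)) = loop_val fls_X * ?F (insert x)"
    unfolding state_sum_scale[symmetric] by (rule state_sum_cong) (simp_all add: nxy)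
  finally have br: "kauffman_bracket H = kauffman_bracket G"
    unfolding twin_factor[OF X e] .
  have ni: "nullity (verts H) (flip_diag (adj_plus_id H) i) = nullity (verts G) (flip_diag (adj_plus_id G) i)"
    if "i \<in> verts G" for i
  proof -
    have "nullity (verts H) (flip_diag (adj_plus_id H) i) = nullity (verts G) (flip_diag (adj_plus_id H) i)"
      unfolding V
      by (rule nullity_nonadjacent_twins)
         (use that xy fin nadj irr twin sym_on_flip_diag[OF sym_on_adj_plus_id[OF H]] in \<open>auto simp: flip_diag_def adj_plus_id_def\<close>)
    then show ?thesis by (simp add: agree_on_nullity_flip_diag[OF ag])
  qed
  \<comment> \<open>Swapping the twins preserves the adjacency. Their coranks agree, so their
    contributions cancel because the labels are opposite.\<close>
  have nx: "nullity (verts H) (flip_diag (adj_plus_id H) y) = nullity (verts H) (flip_diag (adj_plus_id H) x)"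
  proof (rule nullity_iso[where f = "\<lambda>i. if i = x then y else if i = y then x else i"])
    show "finite (verts H)" using V fin by simp
    show "bij_betw (\<lambda>i. if i = x then y else if i = y then x else i) (verts H) (verts H)"
      by (rule bij_betwI[where g = "\<lambda>i. if i = x then y else if i = y then x else i"]) (use V in auto)
    show "flip_diag (adj_plus_id H) y (if i = x then y else if i = y then x else i)
        (if j = x then y else if j = y then x else j) = flip_diag (adj_plus_id H) x i j"
      if "i \<in> verts H" "j \<in> verts H" for i j
      using that V xy twin nadj sy[of i x] sy[of i y] sy[of x y] by (auto simp: flip_diag_def adj_plus_id_def irr)
  qed
  have "writhe H = writhe G"
    using fin xy V lab
    by (simp add: writhe_eq_sum ni[unfolded V] nx[unfolded V] agree_on_lab[OF ag])
  then show ?thesis by (simp add: jones_def br)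
qed

section \<open>The third move\<close>

text \<open>\<open>P e_i = e_i + d i c = e_i\<close>, so the congruence leaves \<open>E_ii\<close>
  fixed.\<close>

lemma congr_flip_diag:
  assumes "finite S" "i \<in> S" "d i = 0"
  shows "congr S c d (flip_diag M i) k l = flip_diag (congr S c d M) i k l"
  using assms by (simp add: congr_def flip_diag_def mulv_flip_diag add_ac)

lemma nullity_flip_diag_congr:
  assumes S: "finite S" "i \<in> S" and sym: "sym_on S M" and cd: "(\<Sum>j\<in>S. c j * d j) = 0"
    and d: "d \<in> supported S" "d i = 0"
    and M': "\<And>i j. i \<in> S \<Longrightarrow> j \<in> S \<Longrightarrow> M' i j = congr S c d M i j"
  shows "nullity S (flip_diag M' i) = nullity S (flip_diag M i)"
proof (rule nullity_congr[OF S(1) sym_on_flip_diag[OF sym] cd d(1)])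
  show "flip_diag M' i k l = congr S c d (flip_diag M i) k l" if "k \<in> S" "l \<in> S" for k l
    using that M' by (simp add: congr_flip_diag S d flip_diag_def)
qed

definition replace_row :: "nat \<Rightarrow> (nat \<Rightarrow> bit) \<Rightarrow> (nat \<Rightarrow> nat \<Rightarrow> bit) \<Rightarrow> nat \<Rightarrow> nat \<Rightarrow> bit" where
  "replace_row u r M i j = (if i = u then if j = u then 0 else r j else if j = u then r i else M i j)"

text \<open>Row and column \<open>v\<close> are added to those of \<open>u\<close>; the new diagonal
  entry is \<open>M u u + M v v\<close> plus twice \<open>M u v\<close>, hence 0 as
  \<open>replace_row\<close> requires.\<close>

lemma nullity_replace_row:
  assumes S: "finite S" "u \<notin> S" "v \<in> S" and sym: "sym_on (insert u S) M"
    and 0: "M u u = 0" "M v v = 0" and r: "\<And>t. t \<in> S \<Longrightarrow> r t = M u t + M v t"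
  shows "nullity (insert u S) (replace_row u r M) = nullity (insert u S) M"
proof (rule nullity_row_ops[where u = v and c = "\<lambda>i. of_bool (i = u)"])
  have s: "M i j = M j i" if "i \<in> insert u S" "j \<in> insert u S" for i j
    using sym that by (auto simp: sym_on_def)
  show "replace_row u r M i j = M i j + of_bool (i = u) * M v j + M i v * of_bool (j = u) +
           of_bool (i = u) * of_bool (j = u) * M v v"
    if "i \<in> insert u S" "j \<in> insert u S" for i j
    using that S 0 s[of u v] s[of i u] s[of i v] r by (auto simp: replace_row_def add.commute)
qed (use S sym in auto)

text \<open>Both sides collapse to \<open>a p + a^-1 (q\<^sub>v + q\<^sub>w) + a q + a^3 m\<close>,
  because \<open>a^-3 + 2 a + a^-1 * loop_val a = a\<close>. The left side belongs to the graph
  before the move.\<close>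

lemma triangle_factor:
  fixes a :: "'a::field"
  assumes "a \<noteq> 0"
  shows "a powi (- 1) * (a powi (- 1) * (a powi (- 1) * p + a powi 1 * q\<^sub>w)
      + a powi 1 * (a powi (- 1) * q\<^sub>v + a powi 1 * q))
    + a powi 1 * (a powi (- 1) * (a powi (- 1) * (loop_val a * p) + a powi 1 * p)
      + a powi 1 * (a powi (- 1) * p + a powi 1 * m)) =
    a powi (- 1) * (a powi 1 * (a powi 1 * p + a powi (- 1) * q\<^sub>w)
      + a powi (- 1) * (a powi 1 * q\<^sub>v + a powi (- 1) * q))
    + a powi 1 * (a powi 1 * (a powi 1 * m + a powi (- 1) * q)
      + a powi (- 1) * (a powi 1 * q + a powi (- 1) * (loop_val a * q)))"
  using assms by (simp add: loop_val_def power_int_minus field_simps power2_eq_square)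

text \<open>The closed neighbourhoods make the new neighbourhood of \<open>u\<close> the symmetric difference of those
  of \<open>v\<close> and \<open>w\<close>, whether or not \<open>v\<close> and \<open>w\<close> are adjacent.\<close>

locale triangle_move =
  fixes G H :: lgraph and u v w :: nat
  assumes G: "labeled_graph G" and H: "labeled_graph H"
    and uvw: "u \<in> verts G" "v \<in> verts G" "w \<in> verts G" "u \<noteq> v" "u \<noteq> w" "v \<noteq> w"
    and labG: "lab G u = - 1" "lab G v = - 1" "lab G w = - 1"
    and nbhd_u: "nbhd G u = {v, w}" and verts: "verts H = verts G"
    and labH: "lab H v = 1" "lab H w = 1" "\<And>x. x \<in> verts G - {v, w} \<Longrightarrow> lab H x = lab G x"
    and adjH: "\<And>x y. x \<in> verts G \<Longrightarrow> y \<in> verts G \<Longrightarrow> x \<noteq> u \<Longrightarrow> y \<noteq> u \<Longrightarrow> adj H x y \<longleftrightarrow> adj G x y"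
    and adjH_u: "\<And>t. t \<in> verts G \<Longrightarrow> t \<noteq> u \<Longrightarrow> adj H u t \<longleftrightarrow> (adj G v t \<noteq> adj G w t)"
begin

definition W where "W = verts G - {u, v, w}"

lemma fin: "finite (verts G)" "finite W"
  using labeled_graph_finite[OF G] by (simp_all add: W_def)

lemma notin_W: "u \<notin> W" "v \<notin> W" "w \<notin> W"
  by (auto simp: W_def)

lemma verts_eq: "verts G = insert u (insert v (insert w W))"
  using uvw by (auto simp: W_def)

lemma adjG_u: "adj G u t \<longleftrightarrow> t = v \<or> t = w" "adj G t u \<longleftrightarrow> t = v \<or> t = w"
proof -
  show 1: "adj G u t \<longleftrightarrow> t = v \<or> t = w"
    using nbhd_u labeled_graph_adj_verts[OF G] unfolding nbhd_def by blast
  have "adj G t u \<longleftrightarrow> adj G u t" by (rule labeled_graph_adj_sym[OF G])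
  then show "adj G t u \<longleftrightarrow> t = v \<or> t = w" using 1 by simp
qed

lemma irr: "\<not> adj G x x" "\<not> adj H x x"
  by (rule labeled_graph_adj_irrefl[OF G], rule labeled_graph_adj_irrefl[OF H])

lemma adj_sym: "adj G x y \<longleftrightarrow> adj G y x" "adj H x y \<longleftrightarrow> adj H y x"
  by (rule labeled_graph_adj_sym[OF G], rule labeled_graph_adj_sym[OF H])

lemma adj_bit_simps:
  "adj_bit G x x = 0" "adj_bit H x x = 0"
  "adj_bit G u t = of_bool (t = v \<or> t = w)" "adj_bit G t u = of_bool (t = v \<or> t = w)"
  by (auto simp: adj_bit_def irr adjG_u)

lemma adj_bit_H_u: "t \<in> verts G \<Longrightarrow> t \<noteq> u \<Longrightarrow> adj_bit H u t = adj_bit G v t + adj_bit G w t"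
  and adj_bit_H: "x \<in> verts G \<Longrightarrow> y \<in> verts G \<Longrightarrow> x \<noteq> u \<Longrightarrow> y \<noteq> u \<Longrightarrow> adj_bit H x y = adj_bit G x y"
  by (auto simp: adj_bit_def adjH_u adjH)

lemma adj_bit_H_u2: "t \<in> verts G \<Longrightarrow> t \<noteq> u \<Longrightarrow> adj_bit H t u = adj_bit G v t + adj_bit G w t"
  using adj_bit_H_u[of t] adj_sym[of t u] by (simp add: adj_bit_def)

lemma adj_bit_H_add:
  assumes "t \<in> verts G" "t \<noteq> u"
  shows "adj_bit G w t = adj_bit H u t + adj_bit H v t" "adj_bit G v t = adj_bit H u t + adj_bit H w t"
  using assms uvw adj_bit_H_u[of t] adj_bit_H[of v t] adj_bit_H[of w t] by (simp_all add: add.commute add.assoc)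

lemma nullity_adj_bit_H:
  assumes "s \<subseteq> verts G" "u \<notin> s"
  shows "nullity s (adj_bit H) = nullity s (adj_bit G)"
  by (rule nullity_cong) (use assms in \<open>auto intro!: adj_bit_H\<close>)

context
  fixes s assumes s: "s \<subseteq> W"
begin

lemma s_facts: "finite s" "u \<notin> s" "v \<notin> s" "w \<notin> s" "\<And>t. t \<in> s \<Longrightarrow> t \<in> verts G"
  using s notin_W fin finite_subset by (auto simp: W_def)

lemma nullity_u: "nullity (insert u s) (adj_bit G) = Suc (nullity s (adj_bit G))"
  using nullity_insert_isolated[of s u "adj_bit G"] s_facts by (auto simp: adj_bit_simps)

lemma nullity_uv: "nullity (insert u (insert v s)) (adj_bit G) = nullity s (adj_bit G)"
  unfolding insert_commute[of u v]
  by (rule nullity_insert_pendant) (use s_facts uvw in \<open>auto simp: adj_bit_simps\<close>)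

lemma nullity_uw: "nullity (insert u (insert w s)) (adj_bit G) = nullity s (adj_bit G)"
  unfolding insert_commute[of u w]
  by (rule nullity_insert_pendant) (use s_facts uvw in \<open>auto simp: adj_bit_simps\<close>)

text \<open>\<open>u\<close> is adjacent to \<open>v\<close> and \<open>w\<close> only. Adding row
  \<open>v\<close> to row \<open>w\<close> removes the entry at \<open>u\<close>, so
  \<open>u\<close> becomes pendant at \<open>v\<close> and both disappear. The remaining row at
  \<open>w\<close> is the sum of rows \<open>v\<close> and \<open>w\<close>, which is row
  \<open>u\<close> of \<open>H\<close>.\<close>

lemma nullity_uvw: "nullity (insert u (insert v (insert w s))) (adj_bit G) = nullity (insert u s) (adj_bit H)"
proof -
  define r where "r = (\<lambda>t. adj_bit G w t + adj_bit G v t)"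
  have "nullity (insert u (insert v (insert w s))) (adj_bit G) = nullity (insert w (insert u (insert v s))) (adj_bit G)"
    by (simp add: insert_commute)
  also have "\<dots> = nullity (insert w (insert u (insert v s))) (replace_row w r (adj_bit G))"
    by (rule nullity_replace_row[symmetric, where v = v])
       (use s_facts uvw in \<open>auto simp: adj_bit_simps r_def intro!: sym_on_adj_bit G\<close>)
  also have "\<dots> = nullity (insert v (insert u (insert w s))) (replace_row w r (adj_bit G))"
    by (simp add: insert_commute)
  also have "\<dots> = nullity (insert w s) (replace_row w r (adj_bit G))"
    by (rule nullity_insert_pendant)
       (use s_facts uvw in \<open>auto simp: adj_bit_simps r_def replace_row_def\<close>)
  also have "\<dots> = nullity (insert u s) (adj_bit H)"
  proof (rule nullity_iso[where f = "\<lambda>i. if i = u then w else i"])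
    show "bij_betw (\<lambda>i. if i = u then w else i) (insert u s) (insert w s)"
      using s_facts by (auto simp: bij_betw_def inj_on_def)
    show "replace_row w r (adj_bit G) (if i = u then w else i) (if j = u then w else j) = adj_bit H i j"
      if "i \<in> insert u s" "j \<in> insert u s" for i j
      using that s_facts uvw
      by (auto simp: replace_row_def r_def adj_bit_simps adj_bit_H adj_bit_H_u adj_bit_H_u2 add.commute)
  qed (use s_facts in auto)
  finally show ?thesis .
qed

text \<open>In \<open>H\<close>, row \<open>u\<close> is the sum of rows \<open>v\<close> and
  \<open>w\<close> of \<open>G\<close>; adding row \<open>v\<close> leaves row \<open>w\<close>, so
  \<open>u\<close> takes over the role of \<open>w\<close>.\<close>

lemma nullity_H_uv: "nullity (insert u (insert v s)) (adj_bit H) = nullity (insert v (insert w s)) (adj_bit G)"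
proof -
  have "nullity (insert u (insert v s)) (adj_bit H) = nullity (insert u (insert v s)) (replace_row u (adj_bit G w) (adj_bit H))"
    by (rule nullity_replace_row[symmetric, where v = v])
       (use s_facts uvw in \<open>auto simp: adj_bit_simps intro!: adj_bit_H_add sym_on_adj_bit H\<close>)
  also have "\<dots> = nullity (insert w (insert v s)) (adj_bit G)"
  proof (rule nullity_iso[where f = "\<lambda>i. if i = w then u else i"])
    show "bij_betw (\<lambda>i. if i = w then u else i) (insert w (insert v s)) (insert u (insert v s))"
      using s_facts uvw by (auto simp: bij_betw_def inj_on_def)
    show "replace_row u (adj_bit G w) (adj_bit H) (if i = w then u else i) (if j = w then u else j) = adj_bit G i j"
      if "i \<in> insert w (insert v s)" "j \<in> insert w (insert v s)" for i j
      using that s_facts uvw adj_sym(1)[of w]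
      by (auto simp: replace_row_def adj_bit_simps adj_bit_H) (auto simp: adj_bit_def)
  qed (use s_facts in auto)
  finally show ?thesis by (simp add: insert_commute)
qed

lemma nullity_H_uw: "nullity (insert u (insert w s)) (adj_bit H) = nullity (insert v (insert w s)) (adj_bit G)"
proof -
  have "nullity (insert u (insert w s)) (adj_bit H) = nullity (insert u (insert w s)) (replace_row u (adj_bit G v) (adj_bit H))"
    by (rule nullity_replace_row[symmetric, where v = w])
       (use s_facts uvw in \<open>auto simp: adj_bit_simps intro!: adj_bit_H_add sym_on_adj_bit H\<close>)
  also have "\<dots> = nullity (insert v (insert w s)) (adj_bit G)"
  proof (rule nullity_iso[where f = "\<lambda>i. if i = v then u else i"])
    show "bij_betw (\<lambda>i. if i = v then u else i) (insert v (insert w s)) (insert u (insert w s))"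
      using s_facts uvw by (auto simp: bij_betw_def inj_on_def)
    show "replace_row u (adj_bit G v) (adj_bit H) (if i = v then u else i) (if j = v then u else j) = adj_bit G i j"
      if "i \<in> insert v (insert w s)" "j \<in> insert v (insert w s)" for i j
      using that s_facts uvw adj_sym(1)[of v]
      by (auto simp: replace_row_def adj_bit_simps adj_bit_H) (auto simp: adj_bit_def)
  qed (use s_facts in auto)
  finally show ?thesis .
qed

text \<open>After row \<open>v\<close> is added to row \<open>u\<close>, the vertices
  \<open>u\<close> and \<open>w\<close> have equal rows.\<close>

lemma nullity_H_uvw:
  "nullity (insert u (insert v (insert w s))) (adj_bit H) = Suc (nullity (insert v (insert w s)) (adj_bit G))"
proof -
  have "nullity (insert u (insert v (insert w s))) (adj_bit H) =
      nullity (insert u (insert v (insert w s))) (replace_row u (adj_bit G w) (adj_bit H))"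
    by (rule nullity_replace_row[symmetric, where v = v])
       (use s_facts uvw in \<open>auto simp: adj_bit_simps intro!: adj_bit_H_add sym_on_adj_bit H\<close>)
  also have "\<dots> = nullity (insert w (insert u (insert v s))) (replace_row u (adj_bit G w) (adj_bit H))"
    by (simp add: insert_commute)
  also have "\<dots> = Suc (nullity (insert w (insert v s)) (replace_row u (adj_bit G w) (adj_bit H)))"
    by (rule nullity_equal_rows)
       (use s_facts uvw adj_sym in \<open>auto simp: replace_row_def adj_bit_simps adj_bit_H sym_on_def adj_bit_def irr adjH\<close>)
  also have "nullity (insert w (insert v s)) (replace_row u (adj_bit G w) (adj_bit H)) = nullity (insert w (insert v s)) (adj_bit G)"
    by (rule nullity_cong) (use s_facts uvw in \<open>auto simp: replace_row_def adj_bit_H\<close>)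
  finally show ?thesis by (simp add: insert_commute)
qed

end

end

context triangle_move
begin

lemma kauffman_bracket_triangle: "kauffman_bracket H = kauffman_bracket G"
proof -
  have X: "(fls_X :: rat fls) \<noteq> 0" by simp
  let ?L = "loop_val fls_X :: rat fls"
  let ?F = "\<lambda>M f. state_sum fls_X W (lab G) (\<lambda>s. ?L ^ nullity (f s) M)"
  have c: "state_sum fls_X W (lab H) f = state_sum fls_X W (lab G) f" for f :: "nat set \<Rightarrow> rat fls"
    by (rule state_sum_cong) (auto simp: W_def labH)
  have labHu: "lab H u = - 1" using labH uvw labG by auto
  have bG: "kauffman_bracket G =
      fls_X powi (- 1) * (fls_X powi (- 1) * (fls_X powi (- 1) * ?F (adj_bit G) (\<lambda>s. s) + fls_X powi 1 * ?F (adj_bit G) (insert w))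
        + fls_X powi 1 * (fls_X powi (- 1) * ?F (adj_bit G) (insert v) + fls_X powi 1 * ?F (adj_bit G) (\<lambda>s. insert v (insert w s))))
    + fls_X powi 1 * (fls_X powi (- 1) * (fls_X powi (- 1) * ?F (adj_bit G) (insert u) + fls_X powi 1 * ?F (adj_bit G) (\<lambda>s. insert u (insert w s)))
        + fls_X powi 1 * (fls_X powi (- 1) * ?F (adj_bit G) (\<lambda>s. insert u (insert v s))
            + fls_X powi 1 * ?F (adj_bit G) (\<lambda>s. insert u (insert v (insert w s)))))"
    unfolding kauffman_bracket_eq[OF G] verts_eq
      state_sum_insert3[OF fin(2) notin_W uvw(4,5,6) X] labG minus_minus ..
  have bH: "kauffman_bracket H =
      fls_X powi (- 1) * (fls_X powi 1 * (fls_X powi 1 * ?F (adj_bit H) (\<lambda>s. s) + fls_X powi (- 1) * ?F (adj_bit H) (insert w))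
        + fls_X powi (- 1) * (fls_X powi 1 * ?F (adj_bit H) (insert v) + fls_X powi (- 1) * ?F (adj_bit H) (\<lambda>s. insert v (insert w s))))
    + fls_X powi 1 * (fls_X powi 1 * (fls_X powi 1 * ?F (adj_bit H) (insert u) + fls_X powi (- 1) * ?F (adj_bit H) (\<lambda>s. insert u (insert w s)))
        + fls_X powi (- 1) * (fls_X powi 1 * ?F (adj_bit H) (\<lambda>s. insert u (insert v s))
            + fls_X powi (- 1) * ?F (adj_bit H) (\<lambda>s. insert u (insert v (insert w s)))))"
    unfolding kauffman_bracket_eq[OF H] verts verts_eq
      state_sum_insert3[OF fin(2) notin_W uvw(4,5,6) X] labHu labH(1,2) c minus_minus ..
  \<comment> \<open>The sixteen partial sums of the two graphs reduce to the five unknowns of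
    \<open>triangle_factor\<close>, up to factors \<open>?L\<close>.\<close>
  have 1: "?F (adj_bit G) (insert u) = ?L * ?F (adj_bit G) (\<lambda>s. s)"
    "?F (adj_bit H) (\<lambda>s. insert u (insert v (insert w s))) = ?L * ?F (adj_bit G) (\<lambda>s. insert v (insert w s))"
    unfolding state_sum_scale[symmetric]
    by (rule state_sum_cong; simp add: nullity_u nullity_H_uvw)+
  have 2: "?F (adj_bit G) (\<lambda>s. insert u (insert v s)) = ?F (adj_bit G) (\<lambda>s. s)"
    "?F (adj_bit G) (\<lambda>s. insert u (insert w s)) = ?F (adj_bit G) (\<lambda>s. s)"
    "?F (adj_bit G) (\<lambda>s. insert u (insert v (insert w s))) = ?F (adj_bit H) (insert u)"
    "?F (adj_bit H) (\<lambda>s. insert u (insert v s)) = ?F (adj_bit G) (\<lambda>s. insert v (insert w s))"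
    "?F (adj_bit H) (\<lambda>s. insert u (insert w s)) = ?F (adj_bit G) (\<lambda>s. insert v (insert w s))"
    by (rule state_sum_cong; simp add: nullity_uv nullity_uw nullity_uvw nullity_H_uv nullity_H_uw)+
  have 3: "?F (adj_bit H) (\<lambda>s. s) = ?F (adj_bit G) (\<lambda>s. s)" "?F (adj_bit H) (insert v) = ?F (adj_bit G) (insert v)"
    "?F (adj_bit H) (insert w) = ?F (adj_bit G) (insert w)"
    "?F (adj_bit H) (\<lambda>s. insert v (insert w s)) = ?F (adj_bit G) (\<lambda>s. insert v (insert w s))"
    using uvw by - (rule state_sum_cong, simp, subst nullity_adj_bit_H, auto simp: W_def)+
  show ?thesis
    unfolding bG bH 1 2 3 by (rule triangle_factor[OF X, symmetric])
qed

text \<open>The matrix \<open>A + E\<close> of \<open>H\<close> arises from that of \<open>G\<close> by adding the rows and columns of \<open>v\<close> and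
  \<open>w\<close> to those of \<open>u\<close>.\<close>

definition c where "c i = (of_bool (i = u) :: bit)"
definition d where "d i = (of_bool (i = v \<or> i = w) :: bit)"

lemma sum_c: "(\<Sum>j\<in>verts G. c j * x j) = x u"
  unfolding c_def using fin uvw by (simp add: sum_of_bool_mult)

lemma d_eq: "d i = of_bool (i = v) + of_bool (i = w)"
  using uvw by (auto simp: d_def)

lemma sum_d: "(\<Sum>j\<in>verts G. x j * d j) = x v + x w"
  unfolding d_eq using fin uvw by (simp add: distrib_left sum.distrib sum_of_bool_mult)

lemma adj_plus_id_congr:
  assumes "i \<in> verts G" "j \<in> verts G"
  shows "adj_plus_id H i j = congr (verts G) c d (adj_plus_id G) i j"
proof -
  have Md: "mulv (verts G) (adj_plus_id G) d i = adj_plus_id G i v + adj_plus_id G i w" for i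
    unfolding mulv_def by (rule sum_d)
  \<comment> \<open>\<open>d^T M d\<close> is the sum of the diagonal entries at \<open>v\<close>
    and \<open>w\<close>, which are both 1, plus twice their common entry.\<close>
  have "(\<Sum>k\<in>verts G. d k * mulv (verts G) (adj_plus_id G) d k) = 0"
    using sum_d[of "mulv (verts G) (adj_plus_id G) d"] uvw adj_sym(1)[of v w]
    by (simp add: Md mult.commute adj_plus_id_def irr)
  then have eq: "congr (verts G) c d (adj_plus_id G) i j = adj_plus_id G i j + c i * (adj_plus_id G j v + adj_plus_id G j w) + (adj_plus_id G i v + adj_plus_id G i w) * c j"
    by (simp add: congr_def Md)
  show ?thesis
    unfolding eq using assms uvw adj_sym(1)[of i v] adj_sym(1)[of i w] adj_sym(1)[of j v] adj_sym(1)[of j w]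
      adj_sym(2)[of i u]
    by (cases "i = u"; cases "j = u") (auto simp: adj_plus_id_def c_def irr adjG_u adjH adjH_u)
qed

lemma d_supported: "d \<in> supported (verts G)"
  using uvw by (auto simp: supported_def d_def)

lemma sum_cd: "(\<Sum>j\<in>verts G. c j * d j) = 0"
  using uvw by (simp add: sum_c d_def)

lemma writhe_triangle:
  assumes K: "knot_like G" "knot_like H"
  shows "writhe H = writhe G"
proof -
  let ?V = "verts G" and ?M = "adj_plus_id G"
  note sym = sym_on_adj_plus_id[OF G, of ?V]
  have nG: "nullity ?V ?M = 0" and nH: "nullity ?V (adj_plus_id H) = 0"
    using K by (simp_all add: knot_like_def verts)
  have "\<exists>z. solves_unit ?V ?M i z" for i
    using exists_mulv_eq[OF fin(1) nG, of "\<lambda>k. of_bool (k = i)"] by (metis solves_unit_def)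
  then obtain z where z: "solves_unit ?V ?M i (z i)" for i by metis
  have comm: "z i j = z j i" if "i \<in> ?V" "j \<in> ?V" for i j
    using solves_unit_commute[OF fin(1) sym that z z] .
  have zs: "z i \<in> supported ?V" "\<And>k. k \<in> ?V \<Longrightarrow> mulv ?V ?M (z i) k = of_bool (k = i)" for i
    using z[of i] by (auto simp: solves_unit_def)
  have row_u: "z i u + z i v + z i w = of_bool (u = i)" for i
  proof -
    have "mulv W ?M (z i) u = 0"
      unfolding mulv_def by (rule sum.neutral) (auto simp: W_def adj_plus_id_def adjG_u)
    then have "mulv ?V ?M (z i) u = z i u + z i v + z i w"
      using fin notin_W uvw by (simp add: verts_eq mulv_insert adj_plus_id_def adjG_u irr add.assoc)
    then show ?thesis using zs(2)[of u i] uvw by simp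
  qed
  \<comment> \<open>The equations \<open>row_u\<close> for \<open>v\<close> and \<open>w\<close> add
    up to \<open>z v v + z w w = z u v + z u w\<close>, and the one for \<open>u\<close> gives the
    value \<open>1 + z u u\<close>.\<close>
  have diag: "z v v + z w w = 1 + z u u"
    using row_u[of u] row_u[of v] row_u[of w] comm[of u v] comm[of u w] comm[of v w] uvw
    by (cases "z u u"; cases "z u v"; cases "z u w"; cases "z v v"; cases "z v w"; cases "z w w") auto
  have flipG: "nullity ?V (flip_diag ?M i) = of_bool (z i i = 1)" if "i \<in> ?V" for i
    by (rule nullity_flip_diag[OF fin(1) that nG z])
  have flipH: "nullity ?V (flip_diag (adj_plus_id H) i) = nullity ?V (flip_diag ?M i)" if "i \<in> ?V" "i \<noteq> v" "i \<noteq> w" for i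
    by (rule nullity_flip_diag_congr[OF fin(1) that(1) sym sum_cd d_supported _ adj_plus_id_congr])
       (use that in \<open>auto simp: d_def\<close>)
  have flipH_vw: "nullity ?V (flip_diag (adj_plus_id H) i) = of_bool (z i i + z u u = 1)" if i: "i = v \<or> i = w" for i
  proof -
    have iV: "i \<in> ?V" "d i = 1" "i \<noteq> u" using i uvw by (auto simp: d_def)
    \<comment> \<open>Here \<open>c\<close> is the unit vector at \<open>u\<close> and
      \<open>d i = 1\<close>, so the equation to solve is \<open>M x = e_i + e_u\<close>.\<close>
    define x where "x = (\<lambda>k. z i k + z u k)"
    have "solves_unit ?V (adj_plus_id H) i (shear ?V c d x)"
    proof (rule solves_unit_congr[OF sym sum_cd d_supported adj_plus_id_congr])
      show "x \<in> supported ?V" unfolding x_def by (intro supported_add zs)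
      show "mulv ?V ?M x k = of_bool (k = i) + d i * c k" if "k \<in> ?V" for k
        unfolding x_def mulv_add using that by (simp add: zs iV c_def)
    qed (use fin iV in auto)
    moreover have "shear ?V c d x i = z i i + z u u"
      using comm[of i u] iV uvw by (simp add: shear_def sum_c x_def add_ac)
    ultimately show ?thesis
      using nullity_flip_diag[OF fin(1) iV(1) nH] by simp
  qed
  let ?g = "\<lambda>G x. (- 1) ^ nullity ?V (flip_diag (adj_plus_id G) x) * lab G x"
  have w: "writhe G = ?g G u + (?g G v + (?g G w + (\<Sum>x\<in>W. ?g G x)))"
    "writhe H = ?g H u + (?g H v + (?g H w + (\<Sum>x\<in>W. ?g H x)))"
    using fin notin_W uvw by (simp_all add: writhe_eq_sum verts verts_eq)
  have "(\<Sum>x\<in>W. ?g H x) = (\<Sum>x\<in>W. ?g G x)"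
    by (rule sum.cong) (auto simp: W_def flipH labH)
  moreover have "?g H u + ?g H v + ?g H w = ?g G u + ?g G v + ?g G w"
  proof -
    have "?g H u = ?g G u" using flipH[of u] uvw labH by simp
    \<comment> \<open>If \<open>z u u = 0\<close>, exactly one of \<open>z v v\<close> and
      \<open>z w w\<close> is 1 and both sums vanish. If \<open>z u u = 1\<close>, both diagonal
      entries flip, which cancels the change of both labels.\<close>
    moreover have "?g H v + ?g H w = ?g G v + ?g G w"
      using diag uvw labG labH
      by (cases "z u u"; cases "z v v"; cases "z w w") (simp_all add: flipH_vw flipG)
    ultimately show ?thesis by simp
  qed
  ultimately show ?thesis unfolding w by simp
qed

end

lemma jones_omega3:
  assumes G: "labeled_graph G" and H: "labeled_graph H" and om: "omega3 closed_nbhd G H"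
    and K: "knot_like G" "knot_like H"
  shows "jones H = jones G"
proof -
  from om obtain u v w where uvw: "u \<in> verts G" "v \<in> verts G" "w \<in> verts G" "u \<noteq> v" "u \<noteq> w" "v \<noteq> w"
    and labG: "lab G u = - 1" "lab G v = - 1" "lab G w = - 1"
    and nb: "nbhd G u = {v, w}" and V: "verts H = verts G"
    and labH: "lab H v = 1" "lab H w = 1" "\<forall>x \<in> verts G - {v, w}. lab H x = lab G x"
    and adj: "\<And>x y. x \<in> verts G \<Longrightarrow> y \<in> verts G \<Longrightarrow> adj H x y \<longleftrightarrow> (adj G x y \<noteq>
       (x = u \<and> y \<in> (closed_nbhd G v - closed_nbhd G w) \<union> (closed_nbhd G w - closed_nbhd G v)
        \<or> y = u \<and> x \<in> (closed_nbhd G v - closed_nbhd G w) \<union> (closed_nbhd G w - closed_nbhd G v)))"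
    unfolding omega3_def Let_def by auto
  have adj_u: "adj G u t \<longleftrightarrow> t = v \<or> t = w" for t
    using nb labeled_graph_adj_verts[OF G] unfolding nbhd_def by blast
  have G': "adj G x y \<longleftrightarrow> adj G y x" "\<not> adj G x x" for x y
    by (rule labeled_graph_adj_sym[OF G], rule labeled_graph_adj_irrefl[OF G])
  interpret triangle_move G H u v w
  proof
    show "adj H x y \<longleftrightarrow> adj G x y" if "x \<in> verts G" "y \<in> verts G" "x \<noteq> u" "y \<noteq> u" for x y
      using adj that by simp
    \<comment> \<open>Among these \<open>t\<close>, only \<open>v\<close> and \<open>w\<close> are
      adjacent to \<open>u\<close> before the move; they lie in the symmetric difference exactly
      when they are not adjacent to each other, and then lose their edge to
      \<open>u\<close>.\<close>
    show "adj H u t \<longleftrightarrow> (adj G v t \<noteq> adj G w t)" if "t \<in> verts G" "t \<noteq> u" for t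
      using adj[OF uvw(1) that(1)] that uvw adj_u[of t] G'(1)[of v w] G'(2)
      by (auto simp: closed_nbhd_def nbhd_def)
  qed (use assms uvw labG nb V labH in auto)
  show ?thesis by (simp add: jones_def kauffman_bracket_triangle writhe_triangle[OF K])
qed

section \<open>The fourth move\<close>

text \<open>\<open>M'\<close> is the Schur complement of the block with rows \<open>(0,1)\<close>
  and \<open>(1,0)\<close> on \<open>u\<close> and \<open>v\<close>. Suitable multiples of row
  \<open>u\<close> clear row \<open>v\<close> on \<open>S\<close>, so \<open>v\<close> becomes
  pendant at \<open>u\<close>.\<close>

lemma nullity_pivot:
  assumes S: "finite S" "u \<notin> S" "v \<notin> S" "u \<noteq> v"
    and sym: "sym_on (insert u (insert v S)) M"
    and M: "M u u = 0" "M v v = 0" "M u v = 1"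
    and M': "\<And>t w. t \<in> S \<Longrightarrow> w \<in> S \<Longrightarrow> M' t w = M t w + M u t * M v w + M v t * M u w"
  shows "nullity (insert u (insert v S)) M = nullity S M'"
proof -
  define c where "c = (\<lambda>i. if i \<in> S then M v i else 0)"
  define M1 where "M1 = (\<lambda>i j. M i j + c i * M u j + M i u * c j + c i * c j * M u u)"
  have s: "M i j = M j i" if "i \<in> insert u (insert v S)" "j \<in> insert u (insert v S)" for i j
    using sym that by (auto simp: sym_on_def)
  have "nullity (insert u (insert v S)) M = nullity (insert u (insert v S)) M1"
    by (rule nullity_row_ops[symmetric, where u = u and c = c])
       (use S sym in \<open>auto simp: c_def M1_def\<close>)
  also have "\<dots> = nullity S M1"
  proof (rule nullity_insert_pendant)
    show "M1 v j = 0 \<and> M1 j v = 0" if "j \<in> S" for j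
      using that S M s[of j v] s[of v u] by (auto simp: M1_def c_def)
    show "M1 v v = 0" "M1 u v = 1" "M1 v u = 1"
      using S M s[of u v] by (simp_all add: M1_def c_def)
  qed (use S in auto)
  also have "\<dots> = nullity S M'"
  proof (rule nullity_cong)
    fix i j assume "i \<in> S" "j \<in> S"
    then show "M1 i j = M' i j"
      using M s[of i u] by (simp add: M1_def c_def M' add_ac mult_ac)
  qed
  finally show ?thesis .
qed

text \<open>The changed pairs are described by an exclusive or instead of \<open>pivot_pair\<close>;
  over the bits the change is then a sum of two products.\<close>

locale pivot_move =
  fixes G H :: lgraph and u v :: nat
  assumes G: "labeled_graph G" and H: "labeled_graph H"
    and uv: "u \<in> verts G" "v \<in> verts G" "adj G u v" and verts: "verts H = verts G"
    and labH: "lab H u = - lab G v" "lab H v = - lab G u"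
      "\<And>x. x \<in> verts G - {u, v} \<Longrightarrow> lab H x = lab G x"
    and adjH: "\<And>x y. x \<in> verts G \<Longrightarrow> y \<in> verts G \<Longrightarrow> x \<in> {u, v} \<or> y \<in> {u, v} \<Longrightarrow> adj H x y \<longleftrightarrow> adj G x y"
    and adjH_other: "\<And>x y. x \<in> verts G - {u, v} \<Longrightarrow> y \<in> verts G - {u, v} \<Longrightarrow>
      adj H x y \<longleftrightarrow> (adj G x y \<noteq> ((adj G u x \<and> adj G v y) \<noteq> (adj G v x \<and> adj G u y)))"
begin

definition W where "W = verts G - {u, v}"

lemma irr: "\<not> adj G x x" "\<not> adj H x x"
  by (rule labeled_graph_adj_irrefl[OF G], rule labeled_graph_adj_irrefl[OF H])

lemma adj_sym: "adj G x y \<longleftrightarrow> adj G y x" "adj H x y \<longleftrightarrow> adj H y x"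
  by (rule labeled_graph_adj_sym[OF G], rule labeled_graph_adj_sym[OF H])

lemma uv_neq: "u \<noteq> v"
  using uv(3) irr(1) by metis

lemma fin: "finite (verts G)" "finite W"
  using labeled_graph_finite[OF G] by (simp_all add: W_def)

lemma notin_W: "u \<notin> W" "v \<notin> W"
  by (auto simp: W_def)

lemma verts_eq: "verts G = insert u (insert v W)"
  using uv by (auto simp: W_def)

lemma adj_bit_self: "adj_bit G x x = 0" "adj_bit H x x = 0" "adj_bit G u v = 1" "adj_bit H u v = 1"
  using uv adjH[of u v] by (auto simp: adj_bit_def irr)

lemma adj_bit_H: "x \<in> verts G \<Longrightarrow> y \<in> verts G \<Longrightarrow> x \<in> {u, v} \<or> y \<in> {u, v} \<Longrightarrow> adj_bit H x y = adj_bit G x y"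
  by (simp add: adj_bit_def adjH)

lemma adj_bit_H_other:
  "x \<in> W \<Longrightarrow> y \<in> W \<Longrightarrow> adj_bit H x y = adj_bit G x y + adj_bit G u x * adj_bit G v y + adj_bit G v x * adj_bit G u y"
  using adjH_other[of x y] unfolding adj_bit_def W_def
  by (cases "adj G x y"; cases "adj G u x"; cases "adj G v y"; cases "adj G v x"; cases "adj G u y") auto

context
  fixes s assumes s: "s \<subseteq> W"
begin

lemma s_facts: "finite s" "u \<notin> s" "v \<notin> s" "\<And>t. t \<in> s \<Longrightarrow> t \<in> verts G" "\<And>t. t \<in> s \<Longrightarrow> t \<in> W"
  using s notin_W fin finite_subset by (auto simp: W_def)

lemma nullity_uv: "nullity (insert u (insert v s)) (adj_bit G) = nullity s (adj_bit H)"
  by (rule nullity_pivot)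
     (use s_facts uv_neq sym_on_adj_bit[OF G] in \<open>auto simp: adj_bit_self adj_bit_H_other\<close>)

lemma nullity_H_uv: "nullity (insert u (insert v s)) (adj_bit H) = nullity s (adj_bit G)"
  by (rule nullity_pivot)
     (use s_facts uv_neq uv sym_on_adj_bit[OF H] in \<open>auto simp: adj_bit_self adj_bit_H_other adj_bit_H add_ac\<close>)

text \<open>As \<open>u\<close> has diagonal entry 0, adding \<open>adj_bit G v i\<close> times row
  \<open>u\<close> to row \<open>i\<close> keeps row \<open>u\<close> and produces exactly the two
  products of the pivot on \<open>s\<close>.\<close>

lemma nullity_H_u: "nullity (insert u s) (adj_bit H) = nullity (insert u s) (adj_bit G)"
proof (rule nullity_row_ops[where u = u and c = "\<lambda>i. if i \<in> s then adj_bit G v i else 0"])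
  show "adj_bit H i j = adj_bit G i j + (if i \<in> s then adj_bit G v i else 0) * adj_bit G u j +
           adj_bit G i u * (if j \<in> s then adj_bit G v j else 0) +
           (if i \<in> s then adj_bit G v i else 0) * (if j \<in> s then adj_bit G v j else 0) * adj_bit G u u"
    if "i \<in> insert u s" "j \<in> insert u s" for i j
    using that s_facts uv adj_sym(1)[of i u]
    by (auto simp: adj_bit_self adj_bit_H_other adj_bit_H add_ac mult_ac) (auto simp: adj_bit_def)
qed (use s_facts sym_on_adj_bit[OF G] in auto)

lemma nullity_H_v: "nullity (insert v s) (adj_bit H) = nullity (insert v s) (adj_bit G)"
proof (rule nullity_row_ops[where u = v and c = "\<lambda>i. if i \<in> s then adj_bit G u i else 0"])
  show "adj_bit H i j = adj_bit G i j + (if i \<in> s then adj_bit G u i else 0) * adj_bit G v j +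
           adj_bit G i v * (if j \<in> s then adj_bit G u j else 0) +
           (if i \<in> s then adj_bit G u i else 0) * (if j \<in> s then adj_bit G u j else 0) * adj_bit G v v"
    if "i \<in> insert v s" "j \<in> insert v s" for i j
    using that s_facts uv adj_sym(1)[of i v]
    by (auto simp: adj_bit_self adj_bit_H_other adj_bit_H add_ac mult_ac) (auto simp: adj_bit_def)
qed (use s_facts sym_on_adj_bit[OF G] in auto)

end

lemma kauffman_bracket_pivot: "kauffman_bracket H = kauffman_bracket G"
proof -
  have X: "(fls_X :: rat fls) \<noteq> 0" by simp
  let ?F = "\<lambda>M f. state_sum fls_X W (lab G) (\<lambda>s. (loop_val fls_X :: rat fls) ^ nullity (f s) M)"
  define a where "a = lab G u"
  define b where "b = lab G v"
  have c: "state_sum fls_X W (lab H) f = state_sum fls_X W (lab G) f" for f :: "nat set \<Rightarrow> rat fls"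
    by (rule state_sum_cong) (auto simp: W_def labH)
  have bG: "kauffman_bracket G =
      fls_X powi a * (fls_X powi b * ?F (adj_bit G) (\<lambda>s. s) + fls_X powi (- b) * ?F (adj_bit G) (insert v))
    + fls_X powi (- a) * (fls_X powi b * ?F (adj_bit G) (insert u) + fls_X powi (- b) * ?F (adj_bit G) (\<lambda>s. insert u (insert v s)))"
    unfolding kauffman_bracket_eq[OF G] verts_eq
      state_sum_insert2[OF fin(2) notin_W uv_neq X] a_def b_def ..
  have bH: "kauffman_bracket H =
      fls_X powi (- b) * (fls_X powi (- a) * ?F (adj_bit H) (\<lambda>s. s) + fls_X powi a * ?F (adj_bit H) (insert v))
    + fls_X powi b * (fls_X powi (- a) * ?F (adj_bit H) (insert u) + fls_X powi a * ?F (adj_bit H) (\<lambda>s. insert u (insert v s)))"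
    unfolding kauffman_bracket_eq[OF H] verts verts_eq
      state_sum_insert2[OF fin(2) notin_W uv_neq X] labH(1,2) c a_def b_def minus_minus ..
  \<comment> \<open>States containing both \<open>u\<close> and \<open>v\<close> trade places with
    those containing neither, and the others stay; the exchanged and negated labels give matching
    exponents.\<close>
  have 1: "?F (adj_bit G) (\<lambda>s. insert u (insert v s)) = ?F (adj_bit H) (\<lambda>s. s)"
    "?F (adj_bit H) (\<lambda>s. insert u (insert v s)) = ?F (adj_bit G) (\<lambda>s. s)"
    "?F (adj_bit H) (insert u) = ?F (adj_bit G) (insert u)"
    "?F (adj_bit H) (insert v) = ?F (adj_bit G) (insert v)"
    by (rule state_sum_cong; simp add: nullity_uv nullity_H_uv nullity_H_u nullity_H_v)+
  show ?thesis
    unfolding bG bH 1 by (simp only: distrib_left add_ac mult_ac)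
qed

text \<open>The matrix \<open>A + E\<close> of \<open>H\<close> arises from that of \<open>G\<close> by adding the rows and columns of both
  \<open>u\<close> and \<open>v\<close> to those of every other neighbour of \<open>u\<close>.\<close>

definition c where "c i = (if i \<in> W then adj_bit G u i else 0)"
definition d where "d i = (of_bool (i = u \<or> i = v) :: bit)"

lemma d_eq: "d i = of_bool (i = u) + of_bool (i = v)"
  using uv_neq by (auto simp: d_def)

lemma sum_d: "(\<Sum>j\<in>verts G. x j * d j) = x u + x v"
  unfolding d_eq using fin uv by (simp add: distrib_left sum.distrib sum_of_bool_mult)

lemma adj_plus_id_congr:
  assumes "i \<in> verts G" "j \<in> verts G"
  shows "adj_plus_id H i j = congr (verts G) c d (adj_plus_id G) i j"
proof -
  have Md: "mulv (verts G) (adj_plus_id G) d i = adj_plus_id G i u + adj_plus_id G i v" for i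
    unfolding mulv_def by (rule sum_d)
  have "(\<Sum>k\<in>verts G. d k * mulv (verts G) (adj_plus_id G) d k) = 0"
    using sum_d[of "mulv (verts G) (adj_plus_id G) d"] uv uv_neq adj_sym(1)[of u v]
    by (simp add: Md mult.commute adj_plus_id_def irr)
  then have eq: "congr (verts G) c d (adj_plus_id G) i j = adj_plus_id G i j + c i * (adj_plus_id G j u + adj_plus_id G j v) + (adj_plus_id G i u + adj_plus_id G i v) * c j"
    by (simp add: congr_def Md)
  have KA: "adj_plus_id G i j = adj_bit G i j + of_bool (i = j)" "adj_plus_id H i j = adj_bit H i j + of_bool (i = j)" for i j
    by (simp_all add: adj_plus_id_def adj_bit_def)
  have s: "adj_bit G i j = adj_bit G j i" for i j using adj_sym by (simp add: adj_bit_def)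
  consider "i \<in> W" "j \<in> W" | "i \<in> W" "j \<in> {u, v}" | "i \<in> {u, v}" "j \<in> W" | "i \<in> {u, v}" "j \<in> {u, v}"
    using assms verts_eq by auto
  then show ?thesis
  proof cases
    \<comment> \<open>The two products of \<open>adj_bit G u i\<close> with
      \<open>adj_bit G u j\<close> cancel, which leaves the pivot term. In the other cases the
      entries at \<open>u\<close> and \<open>v\<close> of rows \<open>u\<close> and \<open>v\<close>
      are all 1, so adding both rows changes nothing.\<close>
    case 1
    then have "i \<noteq> u" "i \<noteq> v" "j \<noteq> u" "j \<noteq> v" using notin_W by auto
    then show ?thesis
      using 1 unfolding eq c_def
      by (simp add: KA adj_bit_H_other s[of i u] s[of i v] s[of j u] s[of j v] distrib_left distrib_right add_ac mult_ac)
  qed (use assms uv uv_neq notin_W s[of u v] in \<open>auto simp: eq c_def KA adj_bit_H adj_bit_self\<close>)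
qed

lemma d_supported: "d \<in> supported (verts G)"
  using uv by (auto simp: supported_def d_def)

lemma sum_cd: "(\<Sum>j\<in>verts G. c j * d j) = 0"
  using notin_W by (simp add: sum_d c_def)

lemma writhe_pivot:
  assumes K: "knot_like G" "knot_like H"
  shows "writhe H = writhe G"
proof -
  let ?V = "verts G" and ?M = "adj_plus_id G"
  note sym = sym_on_adj_plus_id[OF G, of ?V]
  have nG: "nullity ?V ?M = 0" and nH: "nullity ?V (adj_plus_id H) = 0"
    using K by (simp_all add: knot_like_def verts)
  have "\<exists>z. solves_unit ?V ?M i z" for i
    using exists_mulv_eq[OF fin(1) nG, of "\<lambda>k. of_bool (k = i)"] by (metis solves_unit_def)
  then obtain z where z: "solves_unit ?V ?M i (z i)" for i by metis
  have zs: "z i \<in> supported ?V" "\<And>k. k \<in> ?V \<Longrightarrow> mulv ?V ?M (z i) k = of_bool (k = i)" for i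
    using z[of i] by (auto simp: solves_unit_def)
  have sum_c: "(\<Sum>j\<in>?V. c j * y j) = mulv W ?M y u" for y
    using fin notin_W uv_neq
    by (simp add: verts_eq c_def mulv_def) (rule sum.cong, auto simp: adj_bit_def adj_plus_id_def)
  have row_u: "z i u + z i v + mulv W ?M (z i) u = of_bool (u = i)" for i
  proof -
    have "mulv ?V ?M (z i) u = z i u + z i v + mulv W ?M (z i) u"
      using fin notin_W uv uv_neq by (simp add: verts_eq mulv_insert adj_plus_id_def irr add.assoc)
    then show ?thesis using zs(2)[of u i] uv by simp
  qed
  have flipG: "nullity ?V (flip_diag ?M i) = of_bool (z i i = 1)" if "i \<in> ?V" for i
    by (rule nullity_flip_diag[OF fin(1) that nG z])
  have flipH: "nullity ?V (flip_diag (adj_plus_id H) i) = nullity ?V (flip_diag ?M i)" if "i \<in> W" for i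
    by (rule nullity_flip_diag_congr[OF fin(1) _ sym sum_cd d_supported _ adj_plus_id_congr])
       (use that in \<open>auto simp: d_def W_def\<close>)
  have flipH_uv: "nullity ?V (flip_diag (adj_plus_id H) i) = of_bool (z i' i' = 0)"
    if i: "i = u \<and> i' = v \<or> i = v \<and> i' = u" for i i'
  proof -
    have iV: "i \<in> ?V" "d i = 1" using i uv by (auto simp: d_def)
    \<comment> \<open>Column \<open>u\<close> of \<open>M\<close> is \<open>e_u + e_v + c\<close>.
      Adding \<open>M (z i') = e_i'\<close> leaves \<open>e_i + c\<close>, since \<open>i\<close>
      and \<open>i'\<close> are \<open>u\<close> and \<open>v\<close> in some order.\<close>
    define x where "x = (\<lambda>k. of_bool (k = u) + z i' k)"
    have "solves_unit ?V (adj_plus_id H) i (shear ?V c d x)"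
    proof (rule solves_unit_congr[OF sym sum_cd d_supported adj_plus_id_congr])
      show "x \<in> supported ?V" unfolding x_def
        by (intro supported_add zs) (use uv in \<open>auto simp: supported_def\<close>)
      show "mulv ?V ?M x k = of_bool (k = i) + d i * c k" if k: "k \<in> ?V" for k
      proof -
        have "mulv ?V ?M (\<lambda>k. of_bool (k = u)) k = ?M k u"
          unfolding mulv_def using fin uv by (simp add: sum_of_bool_mult)
        moreover have "?M k u = of_bool (k = u) + of_bool (k = v) + c k"
          using k verts_eq notin_W uv uv_neq adj_sym(1)[of k u] by (auto simp: adj_plus_id_def c_def adj_bit_def irr)
        ultimately show ?thesis
          unfolding x_def mulv_add using k i iV uv_neq by (auto simp: zs add_ac)
      qed
    qed (use fin iV in auto)
    moreover have "shear ?V c d x i = 1 + z i' i'"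
    proof -
      have "mulv W ?M x u = mulv W ?M (z i') u"
        using notin_W by (intro mulv_cong) (auto simp: x_def)
      \<comment> \<open>Row \<open>u\<close> of \<open>M (z i') = e_i'\<close> expresses the sum
        over \<open>W\<close> by entries at \<open>u\<close> and \<open>v\<close>.\<close>
      moreover have "mulv W ?M (z i') u = z i' u + z i' v + of_bool (u = i')"
        using row_u[of i'] by (metis add.commute bit_add_self_left)
      ultimately have "(\<Sum>j\<in>?V. c j * x j) = z i' u + z i' v + of_bool (u = i')"
        unfolding sum_c by simp
      then show ?thesis
        using i iV uv_neq by (auto simp: shear_def x_def add_ac)
    qed
    ultimately show ?thesis
      using nullity_flip_diag[OF fin(1) iV(1) nH] by (cases "z i' i'") auto
  qed
  let ?g = "\<lambda>G x. (- 1) ^ nullity ?V (flip_diag (adj_plus_id G) x) * lab G x"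
  have w: "writhe G = ?g G u + (?g G v + (\<Sum>x\<in>W. ?g G x))"
    "writhe H = ?g H u + (?g H v + (\<Sum>x\<in>W. ?g H x))"
    using fin notin_W uv_neq by (simp_all add: writhe_eq_sum verts verts_eq)
  have "(\<Sum>x\<in>W. ?g H x) = (\<Sum>x\<in>W. ?g G x)"
    by (rule sum.cong) (auto simp: flipH labH, auto simp: W_def labH)
  \<comment> \<open>The new diagonal entry at \<open>u\<close> is \<open>1 + z v v\<close>, which
    reverses the sign factor of \<open>v\<close>, and the label is \<open>- lab G v\<close>; the
    contributions of \<open>u\<close> and \<open>v\<close> are thus interchanged.\<close>
  moreover have "?g H u = ?g G v" "?g H v = ?g G u"
    using flipH_uv[of u v] flipH_uv[of v u] flipG[of u] flipG[of v] uv
    by (cases "z u u"; cases "z v v"; simp add: labH)+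
  ultimately show ?thesis unfolding w by simp
qed

end

lemma jones_omega4:
  assumes G: "labeled_graph G" and H: "labeled_graph H" and om: "omega4 G H"
    and K: "knot_like G" "knot_like H"
  shows "jones H = jones G"
proof -
  from om obtain u v where uv: "u \<in> verts G" "v \<in> verts G" "adj G u v" and V: "verts H = verts G"
    and labH: "lab H u = - lab G v" "lab H v = - lab G u" "\<forall>x \<in> verts G - {u, v}. lab H x = lab G x"
    and adj: "\<And>x y. x \<in> verts G \<Longrightarrow> y \<in> verts G \<Longrightarrow>
      adj H x y \<longleftrightarrow> (adj G x y \<noteq> (pivot_pair G u v x y \<or> pivot_pair G u v y x))"
    unfolding omega4_def by auto
  interpret pivot_move G H u v
  proof
    show "adj H x y \<longleftrightarrow> adj G x y" if "x \<in> verts G" "y \<in> verts G" "x \<in> {u, v} \<or> y \<in> {u, v}" for x y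
      using adj[OF that(1,2)] that(3) unfolding pivot_pair_def by blast
    show "adj H x y \<longleftrightarrow> (adj G x y \<noteq> ((adj G u x \<and> adj G v y) \<noteq> (adj G v x \<and> adj G u y)))"
      if "x \<in> verts G - {u, v}" "y \<in> verts G - {u, v}" for x y
    proof -
      have xy: "x \<in> verts G" "y \<in> verts G" "x \<notin> {u, v}" "y \<notin> {u, v}" using that by auto
      have "(pivot_pair G u v x y \<or> pivot_pair G u v y x) \<longleftrightarrow>
          ((adj G u x \<and> adj G v y) \<noteq> (adj G v x \<and> adj G u y))"
        using xy unfolding pivot_pair_def nbhd_def by blast
      then show ?thesis using adj[OF xy(1,2)] by simp
    qed
    show "lab H x = lab G x" if "x \<in> verts G - {u, v}" for x
      using labH(3) that by blast
  qed (fact G H uv V labH)+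
  show ?thesis by (simp add: jones_def kauffman_bracket_pivot writhe_pivot[OF K])
qed

section \<open>Graph-knots\<close>

lemma knot_like_iff:
  "labeled_graph G \<Longrightarrow> knot_like G \<longleftrightarrow> corank (adj_mat G + 1\<^sub>m (order_of G)) = 0"
  by (simp add: knot_like_def corank_adj_mat_plus_one labeled_graph_finite)

lemma jones_graph_move:
  assumes "graph_move closed_nbhd G H" "knot_like G" "knot_like H"
  shows "jones G = jones H"
  using assms jones_iso jones_omega1 jones_omega2 jones_omega3 jones_omega4
  unfolding graph_move_def by metis

lemma graph_link_obtain_representative:
  assumes "K \<in> graph_links N"
  obtains G where "labeled_graph G" "\<And>H. H \<in> K \<longleftrightarrow> labeled_graph H \<and> equivclp (graph_move N) G H"
proof -
  from assms obtain G where "labeled_graph G" "K = link_rel N `` {G}"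
    unfolding graph_links_def by (auto elim: quotientE)
  then show thesis by (intro that[of G]) (auto simp: link_rel_def)
qed

text \<open>Each graph on the chain from \<open>G\<close> to \<open>H\<close> is equivalent to
  \<open>G\<close>, hence in \<open>K\<close> and \<open>knot_like\<close>, so every single move has
  suitable ends.\<close>

lemma jones_eq_representative:
  assumes K: "\<And>H. H \<in> K \<longleftrightarrow> labeled_graph H \<and> equivclp (graph_move closed_nbhd) G H"
    and G: "labeled_graph G" and knot: "\<And>H. H \<in> K \<Longrightarrow> knot_like H"
    and eq: "equivclp (graph_move closed_nbhd) G H"
  shows "jones H = jones G"
  using eq
proof (induction rule: equivclp_induct)
  case base
  show ?case ..
next
  case (step H H')
  have "labeled_graph H" "labeled_graph H'" using step.hyps(2) by (auto simp: graph_move_def)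
  moreover have "equivclp (graph_move closed_nbhd) G H'"
    using step.hyps by (rule equivclp_into_equivclp)
  ultimately have "knot_like H" "knot_like H'" using K knot step.hyps(1) by auto
  then have "jones H' = jones H" using step.hyps(2) jones_graph_move by metis
  with step.IH show ?case by simp
qed

section \<open>Open neighbourhoods: a singular representative in every graph-link\<close>

lemma labeled_graph_induced: "labeled_graph C \<Longrightarrow> S \<subseteq> verts C \<Longrightarrow> labeled_graph (induced C S)"
  unfolding labeled_graph_def induced_def by (auto intro: finite_subset)

text \<open>The moves that attach the gadget run through induced subgraphs of one final graph
  \<open>C\<close>, so each step is checked by adjacencies in \<open>C\<close> alone.\<close>

lemma omega1_induced:
  assumes "x \<notin> S" "\<And>y. y \<in> S \<Longrightarrow> \<not> adj C x y" "\<not> adj C x x"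
  shows "omega1 (induced C S) (induced C (insert x S))"
  unfolding omega1_def agree_on_def nbhd_def induced_def using assms by (intro exI[of _ x]) auto

lemma omega2_induced:
  assumes "x \<noteq> y" "x \<notin> S" "y \<notin> S" "\<not> adj C x y" "lab C x = - lab C y"
    "\<And>t. t \<in> S \<Longrightarrow> adj C x t \<longleftrightarrow> adj C y t"
  shows "omega2 (induced C S) (induced C (insert x (insert y S)))"
  unfolding omega2_def agree_on_def induced_def using assms by (intro exI[of _ x] exI[of _ y]) auto

text \<open>The indicator vector of \<open>T\<close> is a nonzero kernel vector of
  \<open>A + E\<close>.\<close>

lemma not_knot_likeI:
  assumes "finite (verts G)" "T \<subseteq> verts G" "T \<noteq> {}"
    and "\<And>i. i \<in> verts G \<Longrightarrow> (\<Sum>j\<in>T. adj_plus_id G i j) = 0"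
  shows "\<not> knot_like G"
proof -
  define z where "z = (\<lambda>j. of_bool (j \<in> T) :: bit)"
  have "mulv (verts G) (adj_plus_id G) z i = (\<Sum>j\<in>T. adj_plus_id G i j)" for i
    unfolding mulv_def z_def using assms(1,2)
    by (simp add: of_bool_def if_distrib[of "\<lambda>x. adj_plus_id G i _ * x"] sum.If_cases Int_absorb1 cong: if_cong)
  then have "z \<in> null_vecs (verts G) (adj_plus_id G)"
    using assms by (auto simp: null_vecs_def supported_def z_def)
  moreover have "z \<noteq> (\<lambda>_. 0)" using assms(3) by (auto simp: z_def fun_eq_iff)
  ultimately show ?thesis using assms(1) by (auto simp: knot_like_def nullity_eq_0_iff)
qed

lemma induced_verts:
  assumes "labeled_graph C"
  shows "induced C (verts C) = C"
proof -
  have "(\<lambda>x y. x \<in> verts C \<and> y \<in> verts C \<and> adj C x y) = adj C"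
    using labeled_graph_adj_verts[OF assms] by blast
  then show ?thesis by (simp add: induced_def)
qed

text \<open>The gadget is built by the first two moves: isolated vertices \<open>m + 3\<close> and \<open>m + 6\<close>, a pair
  of twins \<open>m + 4, m + 5\<close>, and a pair of twins \<open>m + 7, m + 8\<close>. The third move at \<open>m + 7\<close>
  with neighbours \<open>m + 4\<close> and \<open>m + 6\<close>, read with open neighbourhoods, then creates the kernel
  vector supported on \<open>m + 3, m + 5, m + 6, m + 8\<close>.\<close>

definition gadget_edges :: "nat \<Rightarrow> (nat \<times> nat) set" where
  "gadget_edges m = {(m + 3, m + 4), (m + 3, m + 5), (m + 4, m + 7), (m + 4, m + 8), (m + 6, m + 7), (m + 6, m + 8)}"

text \<open>\<open>m\<close> is meant to exceed all vertices of \<open>G\<close>. The positive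
  labels at \<open>m + 5\<close> and \<open>m + 8\<close> give each twin pair opposite signs, while
  \<open>m + 4\<close>, \<open>m + 6\<close> and \<open>m + 7\<close> are negative as the third move
  demands.\<close>

definition with_gadget :: "nat \<Rightarrow> lgraph \<Rightarrow> lgraph" where
  "with_gadget m G =
     \<lparr>verts = {m + 3..m + 8} \<union> verts G,
      adj = (\<lambda>x y. adj G x y \<or> (x, y) \<in> gadget_edges m \<or> (y, x) \<in> gadget_edges m),
      lab = (\<lambda>x. if x < m then lab G x else if x = m + 5 \<or> x = m + 8 then 1 else - 1)\<rparr>"

text \<open>The open neighbourhoods of \<open>m + 4\<close> and \<open>m + 6\<close> differ only in
  \<open>m + 3\<close>, so the third move adds the single edge between \<open>m + 3\<close> and
  \<open>m + 7\<close>.\<close>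

definition twisted_gadget :: "nat \<Rightarrow> lgraph \<Rightarrow> lgraph" where
  "twisted_gadget m G = (with_gadget m G)
     \<lparr>adj := (\<lambda>x y. adj (with_gadget m G) x y \<or> (x, y) = (m + 3, m + 7) \<or> (x, y) = (m + 7, m + 3)),
      lab := (lab (with_gadget m G))(m + 4 := 1, m + 6 := 1)\<rparr>"

lemma gadget_vertices: "{m + 3..m + 8} = {m + 3, m + 4, m + 5, m + 6, m + 7, m + 8 :: nat}"
  by auto

context
  fixes G :: lgraph and m :: nat
  assumes G: "labeled_graph G" and m: "\<And>x. x \<in> verts G \<Longrightarrow> x < m"
begin

lemma not_adj_fresh: "\<not> adj G (m + k) y" "\<not> adj G y (m + k)"
  using labeled_graph_adj_verts[OF G] m by (meson not_add_less1 less_irrefl)+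

lemma fresh: "m + k \<notin> verts G"
  using m by (meson not_add_less1 less_irrefl)+

lemma labeled_with_gadget: "labeled_graph (with_gadget m G)"
  unfolding labeled_graph_def
proof (intro conjI)
  show "finite (verts (with_gadget m G))"
    using labeled_graph_finite[OF G] by (simp add: with_gadget_def)
  show "\<forall>x y. adj (with_gadget m G) x y \<longrightarrow> x \<in> verts (with_gadget m G) \<and> y \<in> verts (with_gadget m G)"
    using labeled_graph_adj_verts[OF G] by (auto simp: with_gadget_def gadget_edges_def)
  show "\<forall>x y. adj (with_gadget m G) x y \<longrightarrow> adj (with_gadget m G) y x"
    using labeled_graph_adj_sym[OF G] by (auto simp: with_gadget_def)
  show "\<forall>x. \<not> adj (with_gadget m G) x x"
    using labeled_graph_adj_irrefl[OF G] by (auto simp: with_gadget_def gadget_edges_def)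
  show "\<forall>x\<in>verts (with_gadget m G). lab (with_gadget m G) x = 1 \<or> lab (with_gadget m G) x = - 1"
    using labeled_graph_lab[OF G] m by (auto simp: with_gadget_def)
qed

lemma labeled_twisted_gadget: "labeled_graph (twisted_gadget m G)"
  unfolding labeled_graph_def
proof (intro conjI allI impI ballI)
  let ?C = "with_gadget m G"
  note C = labeled_graphD[OF labeled_with_gadget]
  have V: "verts (twisted_gadget m G) = verts ?C" "m + 3 \<in> verts ?C" "m + 7 \<in> verts ?C"
    by (simp_all add: twisted_gadget_def with_gadget_def)
  have adj: "adj (twisted_gadget m G) x y \<longleftrightarrow> adj ?C x y \<or> x = m + 3 \<and> y = m + 7 \<or> x = m + 7 \<and> y = m + 3" for x y
    by (simp add: twisted_gadget_def)
  show "finite (verts (twisted_gadget m G))" using C(1) V by simp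
  show "x \<in> verts (twisted_gadget m G)" "y \<in> verts (twisted_gadget m G)"
    if "adj (twisted_gadget m G) x y" for x y
    using that V C(2)[of x y] unfolding adj by blast+
  show "adj (twisted_gadget m G) y x" if "adj (twisted_gadget m G) x y" for x y
    using that C(3)[of x y] unfolding adj by blast
  show "\<not> adj (twisted_gadget m G) x x" for x
    using C(4)[of x] unfolding adj by simp
  show "lab (twisted_gadget m G) x = 1 \<or> lab (twisted_gadget m G) x = - 1"
    if "x \<in> verts (twisted_gadget m G)" for x
    using that C(5)[of x] V by (simp add: twisted_gadget_def)
qed

lemma adj_with_gadget_fresh:
  "adj (with_gadget m G) (m + 3) y \<longleftrightarrow> y = m + 4 \<or> y = m + 5"
  "adj (with_gadget m G) (m + 4) y \<longleftrightarrow> y = m + 3 \<or> y = m + 7 \<or> y = m + 8"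
  "adj (with_gadget m G) (m + 5) y \<longleftrightarrow> y = m + 3"
  "adj (with_gadget m G) (m + 6) y \<longleftrightarrow> y = m + 7 \<or> y = m + 8"
  "adj (with_gadget m G) (m + 7) y \<longleftrightarrow> y = m + 4 \<or> y = m + 6"
  "adj (with_gadget m G) (m + 8) y \<longleftrightarrow> y = m + 4 \<or> y = m + 6"
  by (auto simp: with_gadget_def gadget_edges_def not_adj_fresh)

lemma omega3_gadget: "omega3 nbhd (with_gadget m G) (twisted_gadget m G)"
  unfolding omega3_def Let_def
proof (intro exI conjI ballI)
  let ?C = "with_gadget m G" and ?D = "twisted_gadget m G"
  have V: "{m + 3, m + 4, m + 5, m + 6, m + 7, m + 8} \<subseteq> verts ?C"
    by (simp add: with_gadget_def)
  have N: "nbhd ?C (m + 7) = {m + 4, m + 6}" "nbhd ?C (m + 4) = {m + 3, m + 7, m + 8}"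
    "nbhd ?C (m + 6) = {m + 7, m + 8}"
    using V by (auto simp: nbhd_def adj_with_gadget_fresh)
  show "{m + 7, m + 4, m + 6} \<subseteq> verts ?C" using V by simp
  show "nbhd ?C (m + 7) = {m + 4, m + 6}" by (rule N)
  show "verts ?D = verts ?C" by (simp add: twisted_gadget_def)
  show "lab ?D x = lab ?C x" if "x \<in> verts ?C - {m + 4, m + 6}" for x
    using that by (simp add: twisted_gadget_def)
  have T: "nbhd ?C (m + 4) - nbhd ?C (m + 6) \<union> (nbhd ?C (m + 6) - nbhd ?C (m + 4)) = {m + 3}"
    unfolding N by auto
  have "\<not> adj ?C (m + 7) (m + 3)" "\<not> adj ?C (m + 3) (m + 7)" by (simp_all add: adj_with_gadget_fresh)
  then show "adj ?D x y \<longleftrightarrow> (adj ?C x y \<noteq>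
      (x = m + 7 \<and> y \<in> nbhd ?C (m + 4) - nbhd ?C (m + 6) \<union> (nbhd ?C (m + 6) - nbhd ?C (m + 4)) \<or>
       y = m + 7 \<and> x \<in> nbhd ?C (m + 4) - nbhd ?C (m + 6) \<union> (nbhd ?C (m + 6) - nbhd ?C (m + 4))))"
    for x y
    unfolding T by (auto simp: twisted_gadget_def)
qed (simp_all add: twisted_gadget_def with_gadget_def)

lemma not_knot_like_twisted_gadget: "\<not> knot_like (twisted_gadget m G)"
proof (rule not_knot_likeI)
  let ?D = "twisted_gadget m G"
  have V: "verts ?D = {m + 3, m + 4, m + 5, m + 6, m + 7, m + 8} \<union> verts G"
    by (simp add: twisted_gadget_def with_gadget_def gadget_vertices)
  show "finite (verts ?D)" by (rule labeled_graph_finite[OF labeled_twisted_gadget])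
  show "{m + 3, m + 5, m + 6, m + 8} \<subseteq> verts ?D" unfolding V by auto
  \<comment> \<open>Every vertex has an even number of closed neighbours in this set. Before the
    twist \<open>m + 7\<close> had only \<open>m + 6\<close>; the new edge supplies
    \<open>m + 3\<close>.\<close>
  show "(\<Sum>j\<in>{m + 3, m + 5, m + 6, m + 8}. adj_plus_id ?D i j) = 0" if "i \<in> verts ?D" for i
  proof (cases "i \<in> verts G")
    case True
    then have "i < m" by (rule m)
    then show ?thesis
      by (simp add: adj_plus_id_def twisted_gadget_def with_gadget_def gadget_edges_def not_adj_fresh)
  next
    case False
    then have "i \<in> {m + 3, m + 4, m + 5, m + 6, m + 7, m + 8}" using that V by auto
    then show ?thesis
      by (auto simp: adj_plus_id_def twisted_gadget_def adj_with_gadget_fresh)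
  qed
qed auto

lemma equivclp_twisted_gadget: "equivclp (graph_move nbhd) G (twisted_gadget m G)"
proof -
  let ?C = "with_gadget m G"
  let ?S0 = "verts G"
  let ?S1 = "insert (m + 3) ?S0"
  let ?S2 = "insert (m + 4) (insert (m + 5) ?S1)"
  let ?S3 = "insert (m + 6) ?S2"
  let ?S4 = "insert (m + 7) (insert (m + 8) ?S3)"
  have V: "verts ?C = ?S4" by (auto simp: with_gadget_def gadget_vertices)
  have lab: "labeled_graph (induced ?C S)" if "S \<subseteq> ?S4" for S
    using that V by (intro labeled_graph_induced labeled_with_gadget) simp
  have old: "\<not> adj ?C (m + 4) y" "\<not> adj ?C (m + 5) y" "\<not> adj ?C (m + 6) y" "\<not> adj ?C (m + 7) y"
    "\<not> adj ?C (m + 8) y" "\<not> adj ?C (m + 3) y" if "y \<in> verts G" for y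
    using m[OF that] by (simp_all add: adj_with_gadget_fresh)
  have lab_C: "lab ?C (m + 4) = - lab ?C (m + 5)" "lab ?C (m + 7) = - lab ?C (m + 8)"
    by (simp_all add: with_gadget_def)
  \<comment> \<open>The two records may differ in labels off the vertex set, so the chain starts
    with the identity as an isomorphism.\<close>
  have "lgraph_iso G (induced ?C ?S0)"
    unfolding lgraph_iso_def
    by (rule exI[of _ id]) (use m in \<open>auto simp: induced_def with_gadget_def gadget_edges_def\<close>)
  then have g0: "graph_move nbhd G (induced ?C ?S0)"
    unfolding graph_move_def using G lab[of ?S0] by blast
  have "omega1 (induced ?C ?S0) (induced ?C ?S1)"
    by (rule omega1_induced) (use old in \<open>auto simp: adj_with_gadget_fresh fresh\<close>)
  then have g1: "graph_move nbhd (induced ?C ?S0) (induced ?C ?S1)"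
    unfolding graph_move_def using lab[of ?S0] lab[of ?S1] by blast
  have "omega2 (induced ?C ?S1) (induced ?C ?S2)"
    by (rule omega2_induced) (use old lab_C in \<open>auto simp: adj_with_gadget_fresh fresh\<close>)
  then have g2: "graph_move nbhd (induced ?C ?S1) (induced ?C ?S2)"
    unfolding graph_move_def using lab[of ?S1] lab[of ?S2] by blast
  have "omega1 (induced ?C ?S2) (induced ?C ?S3)"
    by (rule omega1_induced) (use old in \<open>auto simp: adj_with_gadget_fresh fresh\<close>)
  then have g3: "graph_move nbhd (induced ?C ?S2) (induced ?C ?S3)"
    unfolding graph_move_def using lab[of ?S2] lab[of ?S3] by blast
  have "omega2 (induced ?C ?S3) (induced ?C ?S4)"
    by (rule omega2_induced) (use old lab_C in \<open>auto simp: adj_with_gadget_fresh fresh\<close>)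
  then have "graph_move nbhd (induced ?C ?S3) (induced ?C ?S4)"
    unfolding graph_move_def using lab[of ?S3] lab[of ?S4] by blast
  then have g4: "graph_move nbhd (induced ?C ?S3) ?C"
    using induced_verts[OF labeled_with_gadget] unfolding V by simp
  have g5: "graph_move nbhd ?C (twisted_gadget m G)"
    unfolding graph_move_def using labeled_with_gadget labeled_twisted_gadget omega3_gadget by blast
  note step = r_into_equivclp[of "graph_move nbhd"]
  show ?thesis
    by (rule equivclp_trans[OF step[OF g0] equivclp_trans[OF step[OF g1] equivclp_trans[OF step[OF g2]
      equivclp_trans[OF step[OF g3] equivclp_trans[OF step[OF g4] step[OF g5]]]]]])
qed

end

lemma no_nbhd_graph_knot: "\<not> graph_knot nbhd K"
proof
  assume K: "graph_knot nbhd K"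
  then obtain G where G: "labeled_graph G"
    and mem: "\<And>H. H \<in> K \<longleftrightarrow> labeled_graph H \<and> equivclp (graph_move nbhd) G H"
    by (auto simp: graph_knot_def elim: graph_link_obtain_representative)
  obtain m where m: "\<And>x. x \<in> verts G \<Longrightarrow> x < m"
    using labeled_graph_finite[OF G] finite_nat_set_iff_bounded by auto
  have D: "labeled_graph (twisted_gadget m G)" by (rule labeled_twisted_gadget[OF G m])
  then have "twisted_gadget m G \<in> K"
    using mem equivclp_twisted_gadget[OF G m] by blast
  then have "knot_like (twisted_gadget m G)"
    using K D by (simp add: graph_knot_def knot_like_iff)
  then show False using not_knot_like_twisted_gadget[OF G m] by blast
qed

theorem theorem5p1:
  fixes N :: "lgraph \<Rightarrow> nat \<Rightarrow> nat set" and K :: "lgraph set" and G H :: lgraph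
  assumes "N \<in> {nbhd, closed_nbhd}"
    and "graph_knot N K" and "G \<in> K" and "H \<in> K"
  shows "jones G = jones H"
proof -
  have N: "N = closed_nbhd" using assms no_nbhd_graph_knot by auto
  obtain G0 where G0: "labeled_graph G0"
    and mem: "\<And>H. H \<in> K \<longleftrightarrow> labeled_graph H \<and> equivclp (graph_move closed_nbhd) G0 H"
    using assms(2) by (auto simp: graph_knot_def N elim: graph_link_obtain_representative)
  have "knot_like J" if "J \<in> K" for J
    using assms(2) that mem by (simp add: graph_knot_def knot_like_iff)
  then have "jones J = jones G0" if "J \<in> K" for J
    using that mem G0 by (intro jones_eq_representative[of K]) auto
  then show ?thesis using assms(3,4) by simp
qed

end
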